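(* Let $m$ be an integer. (a) For every $\lambda$-ring $R$, the map $$\tau^m_R:\mathsf W^m(R)\to\mathsf B^m(R),\qquad (a_n)_{n\in\mathbb N}\mapsto\Big(\sum_{d|n}\mathsf M^m\big(a_d,\tfrac nd\big)\Big)_{n\in\mathbb N}$$ is a ring isomorphism satisfying $\Phi^m_R=\varphi^m_R\circ\tau^m_R$. (b) The assignment $R\mapsto\tau^m_R$ is a natural isomorphism between the functors $R\mapsto\mathsf W^m(R)$ and $R\mapsto\mathsf B^m(R)$ on the category of $\lambda$-rings (with $\lambda$-ring homomorphisms).
   Context: Every $\lambda$-ring $R$ is regarded as a $\Psi$-ring with $\Psi^n=\psi^n$, its $n$th Adams operation. For $k\ge1$ let $[k]_m=1+m+\dots+m^{k-1}$. Let $F(x)$ be the free $\lambda$-ring on one generator $x$. Define $\mathsf M^m(x,n)\in\mathbb Q\otimes F(x)$ recursively by $\sum_{d|n}d[\frac nd]_m\psi^{n/d}(\mathsf M^m(x,d))=[n]_mx^n$ for all $n\ge1$; these lie in $F(x)$. For $r\in R$, $\mathsf M^m(r,n)=\pi_r(\mathsf M^m(x,n))$ where $\pi_r:F(x)\to R$ is the unique $\lambda$-ring homomorphism with $x\mapsto r$. $\mathsf W^m(R)$: the commutative ring on $R^{\mathbb N}$ with $(a_n)+(b_n)=(\mathsf S_n(a,b))$, $(a_n)(b_n)=(\mathsf P_n(a,b))$, where $\mathsf S_n,\mathsf P_n\in\mathbb Z[x_d,y_d]$ are defined by $\sum_{d|n}d[\frac nd]_m\mathsf S_d^{n/d}=\sum_{d|n}d[\frac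 nd]_m(x_d^{n/d}+y_d^{n/d})$ and $\sum_{d|n}d[\frac nd]_m\mathsf P_d^{n/d}=(1-m)(\sum_{d|n}d[\frac nd]_mx_d^{n/d})(\sum_{d|n}d[\frac nd]_my_d^{n/d})$; $\Phi^m_R(a)=(\sum_{d|n}d(1-m^{n/d})a_d^{n/d})_n$. $\mathsf B^m(R)$: the commutative ring on $R^{\mathbb N}$ with componentwise addition and multiplication $(a_n)(b_n)=(\pi_{a,b}(P_n))_n$, where $P_n\in\mathbb Z[\Psi^k(x_d),\Psi^k(y_d)]$ (the free $\Psi$-ring on $x_d,y_d$) is defined by $\sum_{d|n}d[\frac nd]_m\Psi^{n/d}(P_d)=(1-m)(\sum_{d|n}d[\frac nd]_m\Psi^{n/d}(x_d))(\sum_{d|n}d[\frac nd]_m\Psi^{n/d}(y_d))$ and $\pi_{a,b}$ is the unique $\Psi$-ring homomorphism with $x_n\mapsto a_n,y_n\mapsto b_n$; $\varphi^m_R(a)=(\sum_{d|n}d(1-m^{n/d})\psi^{n/d}(a_d))_n$. Both maps land in $R^{\mathbb N}$ with componentwise operations; both functors act on morphisms by $\alpha\mapsto f\circ\alpha$. *)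

theory Defs
  imports Complex_Main
begin

text \<open>Integer polynomials in an arbitrary set of variables 'v, represented as
  expressions, evaluated in any commutative ring.  Universal polynomials of the
  paper (those defined by recursions over Q whose integrality is a known fact)
  are chosen by Hilbert choice among integer expressions satisfying the defining
  identity after evaluation at all rational points; two such expressions define
  the same integer polynomial, so their evaluations in every commutative ring agree.\<close>

datatype 'v ipoly = PVar 'v | PConst int | PAdd "'v ipoly" "'v ipoly" | PMul "'v ipoly" "'v ipoly"

fun peval :: "('v \<Rightarrow> 'a::comm_ring_1) \<Rightarrow> 'v ipoly \<Rightarrow> 'a" where
  "peval v (PVar x) = v x"
| "peval v (PConst c) = of_int c"
| "peval v (PAdd p q) = peval v p + peval v q"
| "peval v (PMul p q) = peval v p * peval v q"

definition esym :: "nat \<Rightarrow> 'i set \<Rightarrow> ('i \<Rightarrow> 'a::comm_ring_1) \<Rightarrow> 'a" where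
  "esym n I f = (\<Sum>S\<in>{S. S \<subseteq> I \<and> card S = n}. \<Prod>i\<in>S. f i)"

text \<open>Universal polynomial P_n with lambda^n(xy) = P_n(lambda^1 x,..,lambda^n y);
  Inl i stands for lambda^i(x), Inr j for lambda^j(y).\<close>
definition lamP :: "nat \<Rightarrow> (nat + nat) ipoly" where
  "lamP n = (SOME e. \<forall>(N::nat) (\<xi>::nat \<Rightarrow> rat) (\<eta>::nat \<Rightarrow> rat).
      peval (\<lambda>v. case v of Inl i \<Rightarrow> esym i {..<N} \<xi> | Inr j \<Rightarrow> esym j {..<N} \<eta>) e
      = esym n ({..<N} \<times> {..<N}) (\<lambda>(i,j). \<xi> i * \<eta> j))"

text \<open>Universal polynomial P_{n,k} with lambda^n(lambda^k x) = P_{n,k}(lambda^1 x, ...);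
  variable i stands for lambda^i(x).\<close>
definition lamPP :: "nat \<Rightarrow> nat \<Rightarrow> nat ipoly" where
  "lamPP n k = (SOME e. \<forall>(N::nat) (\<xi>::nat \<Rightarrow> rat).
      peval (\<lambda>i. esym i {..<N} \<xi>) e
      = esym n {T. T \<subseteq> {..<N} \<and> card T = k} (\<lambda>T. \<Prod>i\<in>T. \<xi> i))"

text \<open>A lambda-ring structure (lambda^n)_n on a commutative ring (in the modern sense,
  formerly called special lambda-ring).\<close>
definition lambda_ring :: "(nat \<Rightarrow> 'a::comm_ring_1 \<Rightarrow> 'a) \<Rightarrow> bool" where
  "lambda_ring lam \<longleftrightarrow>
     (\<forall>x. lam 0 x = 1) \<and> (\<forall>x. lam 1 x = x) \<and>
     (\<forall>n x y. lam n (x + y) = (\<Sum>i\<le>n. lam i x * lam (n - i) y)) \<and>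
     (\<forall>n. n \<ge> 2 \<longrightarrow> lam n 1 = 0) \<and>
     (\<forall>n x y. lam n (x * y) =
        peval (\<lambda>v. case v of Inl i \<Rightarrow> lam i x | Inr j \<Rightarrow> lam j y) (lamP n)) \<and>
     (\<forall>n k x. lam n (lam k x) = peval (\<lambda>i. lam i x) (lamPP n k))"

definition lambda_hom :: "(nat \<Rightarrow> 'a::comm_ring_1 \<Rightarrow> 'a) \<Rightarrow> (nat \<Rightarrow> 'b::comm_ring_1 \<Rightarrow> 'b)
    \<Rightarrow> ('a \<Rightarrow> 'b) \<Rightarrow> bool" where
  "lambda_hom lamR lamS f \<longleftrightarrow> f 1 = 1 \<and> (\<forall>x y. f (x + y) = f x + f y) \<and>
     (\<forall>x y. f (x * y) = f x * f y) \<and> (\<forall>n x. f (lamR n x) = lamS n (f x))"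

text \<open>Adams operations via Newton's identity
  psi^n = sum_{i=1}^{n-1} (-1)^(i-1) lambda^i psi^(n-i) + (-1)^(n-1) n lambda^n (n >= 1).\<close>
fun adams :: "(nat \<Rightarrow> 'a::comm_ring_1 \<Rightarrow> 'a) \<Rightarrow> nat \<Rightarrow> 'a \<Rightarrow> 'a" where
  "adams lam n x = (if n = 0 then 0 else
     (\<Sum>i\<in>{1..<n}. (-1) ^ (i + 1) * lam i x * adams lam (n - i) x)
     + (-1) ^ (n + 1) * of_nat n * lam n x)"

definition qbr :: "int \<Rightarrow> nat \<Rightarrow> int" where
  "qbr m k = (\<Sum>i<k. m ^ i)"

text \<open>M^m(x,n) in the free lambda-ring F(x) = Z[lambda^1 x, lambda^2 x, ...], as an integer
  polynomial in the variables i = lambda^i(x).  It is characterized by the recursion,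
  tested after specializing x to a sum of N line elements xi_1..xi_N over Q, where
  lambda^i(x) = e_i(xi) and psi^k acts by xi_j |-> xi_j^k.\<close>
definition Mpoly :: "int \<Rightarrow> nat \<Rightarrow> nat ipoly" where
  "Mpoly m = (SOME Q. \<forall>n\<ge>1. \<forall>(N::nat) (\<xi>::nat \<Rightarrow> rat).
      (\<Sum>d\<in>{d. d dvd n}. of_nat d * of_int (qbr m (n div d)) *
          peval (\<lambda>i. esym i {..<N} (\<lambda>j. \<xi> j ^ (n div d))) (Q d))
      = of_int (qbr m n) * (\<Sum>j<N. \<xi> j) ^ n)"

definition Mm :: "int \<Rightarrow> (nat \<Rightarrow> 'a::comm_ring_1 \<Rightarrow> 'a) \<Rightarrow> 'a \<Rightarrow> nat \<Rightarrow> 'a" where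
  "Mm m lam r n = peval (\<lambda>i. lam i r) (Mpoly m n)"

text \<open>Sequences indexed by N = {1,2,...}; index 0 is a dummy, normalized to 0.\<close>
definition seqs :: "(nat \<Rightarrow> 'a::zero) set" where
  "seqs = {a. a 0 = 0}"

definition WS :: "int \<Rightarrow> nat \<Rightarrow> (nat + nat) ipoly" where
  "WS m = (SOME S. \<forall>n\<ge>1. \<forall>(x::nat \<Rightarrow> rat) (y::nat \<Rightarrow> rat).
      (\<Sum>d\<in>{d. d dvd n}. of_nat d * of_int (qbr m (n div d)) * peval (case_sum x y) (S d) ^ (n div d))
    = (\<Sum>d\<in>{d. d dvd n}. of_nat d * of_int (qbr m (n div d)) * (x d ^ (n div d) + y d ^ (n div d))))"

definition WP :: "int \<Rightarrow> nat \<Rightarrow> (nat + nat) ipoly" where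
  "WP m = (SOME P. \<forall>n\<ge>1. \<forall>(x::nat \<Rightarrow> rat) (y::nat \<Rightarrow> rat).
      (\<Sum>d\<in>{d. d dvd n}. of_nat d * of_int (qbr m (n div d)) * peval (case_sum x y) (P d) ^ (n div d))
    = (1 - of_int m) * (\<Sum>d\<in>{d. d dvd n}. of_nat d * of_int (qbr m (n div d)) * x d ^ (n div d))
                     * (\<Sum>d\<in>{d. d dvd n}. of_nat d * of_int (qbr m (n div d)) * y d ^ (n div d)))"

definition W_add :: "int \<Rightarrow> (nat \<Rightarrow> 'a::comm_ring_1) \<Rightarrow> (nat \<Rightarrow> 'a) \<Rightarrow> nat \<Rightarrow> 'a" where
  "W_add m a b n = (if n = 0 then 0 else peval (case_sum a b) (WS m n))"

definition W_mult :: "int \<Rightarrow> (nat \<Rightarrow> 'a::comm_ring_1) \<Rightarrow> (nat \<Rightarrow> 'a) \<Rightarrow> nat \<Rightarrow> 'a" where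
  "W_mult m a b n = (if n = 0 then 0 else peval (case_sum a b) (WP m n))"

definition Phi :: "int \<Rightarrow> (nat \<Rightarrow> 'a::comm_ring_1) \<Rightarrow> nat \<Rightarrow> 'a" where
  "Phi m a n = (if n = 0 then 0 else
     (\<Sum>d\<in>{d. d dvd n}. of_nat d * (1 - of_int m ^ (n div d)) * a d ^ (n div d)))"

text \<open>Free Psi-ring on x_d, y_d: polynomial ring in variables (c,d,k) = Psi^k(x_d) if c,
  Psi^k(y_d) otherwise (k >= 1); Psi^j acts by (c,d,k) |-> (c,d,j*k).\<close>
definition BP :: "int \<Rightarrow> nat \<Rightarrow> (bool \<times> nat \<times> nat) ipoly" where
  "BP m = (SOME P. \<forall>n\<ge>1. \<forall>(v::bool \<times> nat \<times> nat \<Rightarrow> rat).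
      (\<Sum>d\<in>{d. d dvd n}. of_nat d * of_int (qbr m (n div d)) *
          peval (\<lambda>(c,e,k). v (c, e, (n div d) * k)) (P d))
    = (1 - of_int m) * (\<Sum>d\<in>{d. d dvd n}. of_nat d * of_int (qbr m (n div d)) * v (True, d, n div d))
                     * (\<Sum>d\<in>{d. d dvd n}. of_nat d * of_int (qbr m (n div d)) * v (False, d, n div d)))"

definition B_add :: "(nat \<Rightarrow> 'a::comm_ring_1) \<Rightarrow> (nat \<Rightarrow> 'a) \<Rightarrow> nat \<Rightarrow> 'a" where
  "B_add a b n = a n + b n"

definition B_mult :: "int \<Rightarrow> (nat \<Rightarrow> 'a::comm_ring_1 \<Rightarrow> 'a) \<Rightarrow> (nat \<Rightarrow> 'a) \<Rightarrow> (nat \<Rightarrow> 'a) \<Rightarrow> nat \<Rightarrow> 'a" where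
  "B_mult m lam a b n = (if n = 0 then 0 else
     peval (\<lambda>(c,e,k). adams lam k (if c then a e else b e)) (BP m n))"

definition phi :: "int \<Rightarrow> (nat \<Rightarrow> 'a::comm_ring_1 \<Rightarrow> 'a) \<Rightarrow> (nat \<Rightarrow> 'a) \<Rightarrow> nat \<Rightarrow> 'a" where
  "phi m lam a n = (if n = 0 then 0 else
     (\<Sum>d\<in>{d. d dvd n}. of_nat d * (1 - of_int m ^ (n div d)) * adams lam (n div d) (a d)))"

definition tau :: "int \<Rightarrow> (nat \<Rightarrow> 'a::comm_ring_1 \<Rightarrow> 'a) \<Rightarrow> (nat \<Rightarrow> 'a) \<Rightarrow> nat \<Rightarrow> 'a" where
  "tau m lam a n = (if n = 0 then 0 else (\<Sum>d\<in>{d. d dvd n}. Mm m lam (a d) (n div d)))"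

end

theory Submission
  imports Defs "HOL-Computational_Algebra.Computational_Algebra" "HOL-Library.Function_Algebras"
begin

text \<open>Over a torsion-free lambda-ring the theorem is formal: summing the recursion for
  \<open>M\<^sup>m\<close> over divisors shows that \<open>\<tau>\<^sup>m\<close> carries the Witt ghost components of parameter \<open>m\<close> to the
  ghost components built from Adams operations, and the latter are injective.  A general lambda-ring
  is reached through a free model, the functions of power-sum coordinates over the rationals: an
  identity between expressions in lambda-operations which holds in the model holds everywhere,
  because integer polynomials are determined by their rational values.

  All universal polynomials are first obtained with denominators.  The lambda-ring ones have \<open>n!\<close> as
  denominator by Newton's identities, which is removed because the elementary symmetric polynomials
  are algebraically independent modulo every integer.  The others are integral by a variant of
  Dwork's lemma: for a prime \<open>p\<close> dividing \<open>1 - m\<close> each coefficient \<open>d [n/d]\<^sub>m\<close> is divisible by the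
  \<open>p\<close>-part of \<open>n\<close>; for other \<open>p\<close> one multiplies by \<open>1 - m\<close> and argues as in the classical case.\<close>

section \<open>Evaluation of integer polynomial expressions\<close>

text \<open>The ghost maps in the theorem carry a factor 1 - m, so for m = 1 they vanish and can
  separate nothing. The comparison is therefore made with the coefficients d [n/d]_m, whose value at
  d = n is n because [1]_m = 1. The brackets in turn spoil the classical congruence argument: when a
  prime p divides both k and 1 - m, [k]_m and [k/p]_m need not agree modulo the p-part of k, as m =
  1 shows, whereas 1 - m^k and 1 - m^(k/p) always do. For p not dividing 1 - m this factor is
  invertible modulo powers of p and can be inserted and removed at will. Hence the two cases. Every
  universal polynomial is a Hilbert choice, so nothing is known about it before an integral solution
  of its defining identity has been exhibited; this is why existence proofs take so much room. The
  model avoids that effort for the lambda-operations: with rational values Newton's recursion is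
  solved by division, and no integrality has to be checked.\<close>

definition unital_hom :: "('a::comm_ring_1 \<Rightarrow> 'b::comm_ring_1) \<Rightarrow> bool" where
  "unital_hom f \<longleftrightarrow> f 1 = 1 \<and> (\<forall>x y. f (x + y) = f x + f y) \<and> (\<forall>x y. f (x * y) = f x * f y)"

lemma unital_hom_of_nat:
  assumes "unital_hom f" shows "f (of_nat n) = of_nat n"
proof (induction n)
  case 0
  have "f (0 + 0) = f 0 + f 0" using assms unfolding unital_hom_def by blast
  then show ?case by simp
next
  case (Suc n)
  then show ?case using assms by (simp add: unital_hom_def)
qed

lemma unital_hom_0: "unital_hom f \<Longrightarrow> f 0 = 0"
  using unital_hom_of_nat[of f 0] by simp

lemma unital_hom_minus:
  assumes "unital_hom f" shows "f (- x) = - f x"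
proof -
  have "f x + f (- x) = f (x + - x)" using assms unfolding unital_hom_def by metis
  then show ?thesis using unital_hom_0[OF assms] by (simp add: eq_neg_iff_add_eq_0 add.commute)
qed

lemma unital_hom_diff: "unital_hom f \<Longrightarrow> f (x - y) = f x - f y"
  using unital_hom_minus[of f y] unfolding unital_hom_def by (metis uminus_add_conv_diff add.commute)

lemma unital_hom_of_int:
  assumes "unital_hom f" shows "f (of_int c) = of_int c"
  by (cases c) (simp_all add: unital_hom_of_nat[OF assms] unital_hom_minus[OF assms] del: of_nat_Suc)

lemma unital_hom_sum:
  assumes "unital_hom f" shows "f (sum g A) = (\<Sum>i\<in>A. f (g i))"
  using assms by (induction A rule: infinite_finite_induct) (auto simp: unital_hom_0 unital_hom_def)

lemma unital_hom_power:
  assumes "unital_hom f" shows "f (x ^ n) = f x ^ n"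
  using assms by (induction n) (auto simp: unital_hom_def)

lemma unital_hom_peval:
  assumes "unital_hom f" shows "f (peval w p) = peval (\<lambda>v. f (w v)) p"
  using assms by (induction p) (auto simp: unital_hom_of_int, auto simp: unital_hom_def)

lemma peval_cong: "(\<And>v. v \<in> set_ipoly p \<Longrightarrow> w v = w' v) \<Longrightarrow> peval w p = peval w' p"
  by (induction p) auto

definition psum :: "'v ipoly list \<Rightarrow> 'v ipoly" where
  "psum ps = foldr PAdd ps (PConst 0)"

lemma peval_psum [simp]: "peval w (psum ps) = sum_list (map (peval w) ps)"
  by (induction ps) (auto simp: psum_def)

lemma set_psum: "set_ipoly (psum ps) = \<Union>(set_ipoly ` set ps)"
  by (induction ps) (auto simp: psum_def)

primrec psubst :: "('u \<Rightarrow> 'v ipoly) \<Rightarrow> 'u ipoly \<Rightarrow> 'v ipoly" where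
  "psubst s (PVar x) = s x"
| "psubst s (PConst c) = PConst c"
| "psubst s (PAdd p q) = PAdd (psubst s p) (psubst s q)"
| "psubst s (PMul p q) = PMul (psubst s p) (psubst s q)"

lemma peval_psubst [simp]: "peval w (psubst s p) = peval (\<lambda>v. peval w (s v)) p"
  by (induction p) auto

text \<open>Coefficients are computed syntactically, so that they are again integer expressions with
  a value in every ring; a coefficient read off from rational values would have lost its
  integrality.\<close>

fun pcoef :: "'v \<Rightarrow> 'v ipoly \<Rightarrow> nat \<Rightarrow> 'v ipoly" where
  "pcoef x (PVar y) k =
     (if y = x then PConst (if k = 1 then 1 else 0) else if k = 0 then PVar y else PConst 0)"
| "pcoef x (PConst c) k = PConst (if k = 0 then c else 0)"
| "pcoef x (PAdd p q) k = PAdd (pcoef x p k) (pcoef x q k)"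
| "pcoef x (PMul p q) k = psum (map (\<lambda>i. PMul (pcoef x p i) (pcoef x q (k - i))) [0..<Suc k])"

primrec pdeg :: "'v ipoly \<Rightarrow> nat" where
  "pdeg (PVar y) = 1"
| "pdeg (PConst c) = 0"
| "pdeg (PAdd p q) = max (pdeg p) (pdeg q)"
| "pdeg (PMul p q) = pdeg p + pdeg q"

lemma set_pcoef: "set_ipoly (pcoef x p k) \<subseteq> set_ipoly p - {x}"
proof (induction p arbitrary: k)
  case (PMul p q)
  then show ?case by (fastforce simp: set_psum simp del: upt_Suc)
next
  case (PAdd p q)
  then show ?case by (fastforce simp: subset_iff)
qed auto

text \<open>The bridge to univariate polynomials: with the other variables frozen at
  \<open>w\<close>, degree bounds and uniqueness over an infinite field become available for
  \<open>pcoef\<close>.\<close>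

definition upoly :: "'v \<Rightarrow> ('v \<Rightarrow> 'a::comm_ring_1) \<Rightarrow> 'v ipoly \<Rightarrow> 'a poly" where
  "upoly x w p = peval (\<lambda>u. if u = x then [:0, 1:] else [:w u:]) p"

lemma coeff_upoly: "coeff (upoly x w p) k = peval w (pcoef x p k)"
proof (induction p arbitrary: k)
  case (PVar y)
  then show ?case by (auto simp: upoly_def coeff_pCons split: nat.split)
next
  case (PConst c)
  then show ?case by (simp add: upoly_def of_int_poly coeff_pCons split: nat.split)
next
  case (PAdd p q)
  then show ?case by (simp add: upoly_def)
next
  case (PMul p q)
  have "coeff (upoly x w (PMul p q)) k = (\<Sum>i\<le>k. coeff (upoly x w p) i * coeff (upoly x w q) (k - i))"
    by (simp add: upoly_def coeff_mult)
  also have "\<dots> = (\<Sum>i\<leftarrow>[0..<Suc k]. peval w (pcoef x p i) * peval w (pcoef x q (k - i)))"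
    unfolding PMul.IH by (simp add: sum_list_distinct_conv_sum_set atLeast0LessThan lessThan_Suc_atMost del: upt_Suc)
  finally show ?case by (simp add: comp_def del: upt_Suc)
qed

lemma poly_upoly: "poly (upoly x w p) t = peval (w(x := t)) p"
proof -
  have "unital_hom (\<lambda>q. poly q t)" by (simp add: unital_hom_def)
  from unital_hom_peval[OF this, of "\<lambda>u. if u = x then [:0, 1:] else [:w u:]" p] show ?thesis
    by (auto simp: upoly_def intro!: peval_cong)
qed

lemma degree_upoly: "degree (upoly x w p) \<le> pdeg p"
proof (induction p)
  case (PAdd p q)
  then show ?case by (auto simp: upoly_def intro!: degree_add_le)
next
  case (PMul p q)
  then show ?case using degree_mult_le[of "upoly x w p" "upoly x w q"] by (simp add: upoly_def)
qed (simp_all add: upoly_def)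

lemma pcoef_above_pdeg: "pdeg p < k \<Longrightarrow> peval w (pcoef x p k) = 0"
  using degree_upoly[of x w p] by (metis coeff_upoly coeff_eq_0 le_less_trans)

lemma peval_expand: "peval w p = (\<Sum>k\<le>pdeg p. peval w (pcoef x p k) * w x ^ k)"
proof -
  have "peval w p = poly (upoly x w p) (w x)" by (simp add: poly_upoly)
  also have "\<dots> = (\<Sum>k\<le>degree (upoly x w p). peval w (pcoef x p k) * w x ^ k)"
    by (simp add: poly_altdef coeff_upoly)
  also have "\<dots> = (\<Sum>k\<le>pdeg p. peval w (pcoef x p k) * w x ^ k)"
    using degree_upoly[of x w p]
    by (intro sum.mono_neutral_left) (auto simp: coeff_upoly[symmetric] coeff_eq_0)
  finally show ?thesis .
qed

lemma pcoef_upd [simp]: "peval (w(x := t)) (pcoef x p k) = peval w (pcoef x p k)"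
  using set_pcoef[of x p k] by (intro peval_cong) auto

lemma pcoef_cong_rat:
  assumes "\<And>w :: 'v \<Rightarrow> rat. peval w p = peval w q"
  shows "peval (w :: 'v \<Rightarrow> rat) (pcoef x p k) = peval w (pcoef x q k)"
proof -
  have "upoly x w p = upoly x w q"
    using assms by (simp add: poly_eq_poly_eq_iff[symmetric] poly_upoly fun_eq_iff)
  then show ?thesis by (metis coeff_upoly)
qed

text \<open>Induction over the variables that occur. After expansion in powers of one of them, each
  coefficient vanishes at all rational points and involves fewer variables.\<close>

lemma peval_eq_0_transfer:
  fixes p :: "'v ipoly" and w :: "'v \<Rightarrow> 'a::comm_ring_1"
  assumes "\<And>w :: 'v \<Rightarrow> rat. peval w p = 0"
  shows "peval w p = 0"
proof -
  have "peval w p = 0" if "finite V" "set_ipoly p \<subseteq> V" "\<And>w :: 'v \<Rightarrow> rat. peval w p = 0" for V p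
    using that
  proof (induction V arbitrary: p rule: finite_induct)
    case empty
    \<comment> \<open>Without variables an expression is an integer, and an integer that is zero in
      the rationals is zero in every ring.\<close>
    have const: "peval w' p = of_int (peval (\<lambda>_. 0) p)" for w' :: "'v \<Rightarrow> 'c::comm_ring_1"
    proof -
      have "unital_hom (of_int :: int \<Rightarrow> 'c)" by (simp add: unital_hom_def)
      from unital_hom_peval[OF this, of "\<lambda>_. 0" p] empty(1) show ?thesis
        by (auto intro!: peval_cong)
    qed
    have "(of_int (peval (\<lambda>_. 0) p) :: rat) = 0" using empty(2) const by metis
    then show ?case using const[of w] by simp
  next
    case (insert x V)
    have "peval w (pcoef x p k) = 0" for k
    proof (rule insert.IH)
      show "set_ipoly (pcoef x p k) \<subseteq> V" using set_pcoef[of x p k] insert.prems(1) by blast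
      show "peval u (pcoef x p k) = 0" for u :: "'v \<Rightarrow> rat"
        using pcoef_cong_rat[of p "PConst 0" u x k] insert.prems(2) by simp
    qed
    then show ?case by (subst peval_expand[of _ _ x]) simp
  qed
  from this[of "set_ipoly p"] show ?thesis using assms by simp
qed

lemma peval_eq_transfer:
  fixes p q :: "'v ipoly" and w :: "'v \<Rightarrow> 'a::comm_ring_1"
  assumes "\<And>w :: 'v \<Rightarrow> rat. peval w p = peval w q"
  shows "peval w p = peval w q"
  using peval_eq_0_transfer[of "PAdd p (PMul (PConst (-1)) q)" w] assms by simp

section \<open>Newton's identities\<close>

text \<open>If \<open>w\<close> lists elementary symmetric functions, these are the power sums. It
  is the recursion of \<open>adams\<close> with the lambda-values replaced by any sequence, so that
  the same lemmas serve rational points, polynomial rings and lambda-rings.\<close>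

fun npow :: "(nat \<Rightarrow> 'a::comm_ring_1) \<Rightarrow> nat \<Rightarrow> 'a" where
  "npow w n = (if n = 0 then 0 else
     (\<Sum>i\<in>{1..<n}. (-1) ^ (i + 1) * w i * npow w (n - i)) + (-1) ^ (n + 1) * of_nat n * w n)"

declare npow.simps [simp del] adams.simps [simp del]

lemma npow_0 [simp]: "npow w 0 = 0"
  by (simp add: npow.simps)

lemma adams_eq_npow: "adams lam n x = npow (\<lambda>i. lam i x) n"
proof (induction n rule: less_induct)
  case (less n)
  then show ?case by (subst adams.simps, subst npow.simps) (auto intro!: sum.cong)
qed

text \<open>As an expression, Newton's recursion can be substituted into other universal polynomials
  and transferred along with them.\<close>

function newtonp :: "nat \<Rightarrow> nat ipoly" where
  "newtonp n = (if n = 0 then PConst 0 else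
     PAdd (psum (map (\<lambda>i. PMul (PMul (PConst ((-1) ^ (i + 1))) (PVar i)) (newtonp (n - i))) [1..<n]))
       (PMul (PConst ((-1) ^ (n + 1) * int n)) (PVar n)))"
  by auto
termination by (relation "measure id") auto

declare newtonp.simps [simp del]

lemma peval_newtonp [simp]: "peval w (newtonp n) = npow w n"
proof (induction n rule: less_induct)
  case (less n)
  have "npow w n = (\<Sum>i\<leftarrow>[1..<n]. (-1) ^ (i + 1) * w i * peval w (newtonp (n - i)))
      + (-1) ^ (n + 1) * of_nat n * w n" if "n \<noteq> 0"
    using less that by (subst npow.simps) (auto simp: sum_list_distinct_conv_sum_set intro!: sum.cong)
  then show ?case
    by (subst newtonp.simps) (auto simp: comp_def)
qed

text \<open>With w_0 = 1 the power sum of index n becomes the summand i = 0, so Newton's identity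
  takes the form of a convolution and suits generating series.\<close>

lemma newton_recurrence:
  assumes "w 0 = 1"
  shows "of_nat n * w n = (\<Sum>i<n. w i * ((-1) ^ (n - i + 1) * npow w (n - i)))"
proof (cases "n = 0")
  case False
  have "(-1) ^ (n + 1) * npow w n
      = (\<Sum>i\<in>{1..<n}. (-1) ^ (n + 1) * ((-1) ^ (i + 1) * w i * npow w (n - i)))
        + (-1) ^ (n + 1) * ((-1) ^ (n + 1) * of_nat n * w n)"
    using False by (subst npow.simps) (simp only: if_False distrib_left sum_distrib_left)
  also have "(-1) ^ (n + 1) * ((-1) ^ (n + 1) * of_nat n * w n) = of_nat n * w n"
    by (simp add: mult.assoc[symmetric] power_add[symmetric])
  also have "(\<Sum>i\<in>{1..<n}. (-1) ^ (n + 1) * ((-1) ^ (i + 1) * w i * npow w (n - i)))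
      = - (\<Sum>i\<in>{1..<n}. w i * ((-1) ^ (n - i + 1) * npow w (n - i)))"
    unfolding sum_negf[symmetric]
  proof (rule sum.cong[OF refl])
    fix i assume i: "i \<in> {1..<n}"
    then obtain j where "n = i + j" using i nat_le_iff_add[of i n] by auto
    then have "(-1 :: 'a) ^ (n + 1) * (-1) ^ (i + 1) = - ((-1) ^ (n - i + 1))"
      by (cases "even i") (simp_all add: power_add)
    then show "(-1) ^ (n + 1) * ((-1) ^ (i + 1) * w i * npow w (n - i))
        = - (w i * ((-1) ^ (n - i + 1) * npow w (n - i)))"
      by (simp add: mult.assoc[symmetric])
  qed
  finally have npow: "(-1) ^ (n + 1) * npow w n
      = - (\<Sum>i\<in>{1..<n}. w i * ((-1) ^ (n - i + 1) * npow w (n - i))) + of_nat n * w n" .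
  have "{..<n} = insert 0 {1..<n}" using False by auto
  then have "(\<Sum>i<n. w i * ((-1) ^ (n - i + 1) * npow w (n - i)))
      = (-1) ^ (n + 1) * npow w n + (\<Sum>i\<in>{1..<n}. w i * ((-1) ^ (n - i + 1) * npow w (n - i)))"
    using assms by simp
  with npow show ?thesis by simp
qed simp

text \<open>The recurrence determines p_n without division, its coefficient being w_0 = 1 up to
  sign. So uniqueness holds in every commutative ring.\<close>

lemma npow_unique:
  fixes w :: "nat \<Rightarrow> 'a::comm_ring_1"
  assumes "w 0 = 1"
    and rec: "\<And>n. n > 0 \<Longrightarrow> of_nat n * w n = (\<Sum>i<n. w i * ((-1) ^ (n - i + 1) * p (n - i)))"
    and "n > 0"
  shows "npow w n = p n"
  using \<open>n > 0\<close>
proof (induction n rule: less_induct)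
  case (less n)
  have split: "{..<n} = insert 0 {1..<n}" using less.prems by auto
  have eq: "(\<Sum>i\<in>{1..<n}. w i * ((-1) ^ (n - i + 1) * npow w (n - i)))
      = (\<Sum>i\<in>{1..<n}. w i * ((-1) ^ (n - i + 1) * p (n - i)))"
    using less.IH by (intro sum.cong) auto
  have "(\<Sum>i<n. w i * ((-1) ^ (n - i + 1) * npow w (n - i)))
      = (\<Sum>i<n. w i * ((-1) ^ (n - i + 1) * p (n - i)))"
    using newton_recurrence[of w n] rec[OF less.prems] assms(1) by simp
  then have "(-1) ^ (n + 1) * npow w n = (-1) ^ (n + 1) * p n"
    using eq assms(1) unfolding split by simp
  then have "(-1) ^ (n + 1) * ((-1) ^ (n + 1) * npow w n) = (-1) ^ (n + 1) * ((-1) ^ (n + 1) * p n)"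
    by simp
  then show ?case by (simp add: mult.assoc[symmetric] power_add[symmetric])
qed

text \<open>The signed power sums are the coefficients of X W'/W, where W is the generating series
  of \<open>w\<close>.\<close>

lemma newton_fps:
  fixes w :: "nat \<Rightarrow> 'a::comm_ring_1"
  assumes "w 0 = 1"
  shows "fps_X * fps_deriv (Abs_fps w) = Abs_fps w * Abs_fps (\<lambda>n. (-1) ^ (n + 1) * npow w n)"
proof (rule fps_ext)
  fix n
  have "(fps_X * fps_deriv (Abs_fps w)) $ n = of_nat n * w n"
    by (cases n) auto
  also have "\<dots> = (\<Sum>i<n. w i * ((-1) ^ (n - i + 1) * npow w (n - i)))"
    by (rule newton_recurrence) (fact assms)
  also have "\<dots> = (\<Sum>i\<in>{0..n}. w i * ((-1) ^ (n - i + 1) * npow w (n - i)))"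
    by (intro sum.mono_neutral_left) auto
  finally show "(fps_X * fps_deriv (Abs_fps w)) $ n
      = (Abs_fps w * Abs_fps (\<lambda>n. (-1) ^ (n + 1) * npow w n)) $ n"
    by (simp add: fps_mult_nth)
qed

text \<open>The logarithmic derivative turns a product of generating series into a sum. In a
  lambda-ring this is the additivity of the Adams operations.\<close>

lemma npow_convolution:
  fixes w w' :: "nat \<Rightarrow> 'a::comm_ring_1"
  assumes "w 0 = 1" "w' 0 = 1"
  shows "npow (\<lambda>n. \<Sum>i\<le>n. w i * w' (n - i)) n = npow w n + npow w' n"
proof (cases "n = 0")
  case False
  define c where "c = (\<lambda>n. \<Sum>i\<le>n. w i * w' (n - i))"
  let ?P = "\<lambda>w. Abs_fps (\<lambda>n. (-1) ^ (n + 1) * npow w n)"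
  have c: "Abs_fps c = Abs_fps w * Abs_fps w'"
    by (rule fps_ext) (simp add: c_def fps_mult_nth atLeast0AtMost)
  have "fps_X * fps_deriv (Abs_fps c)
      = Abs_fps w' * (fps_X * fps_deriv (Abs_fps w)) + Abs_fps w * (fps_X * fps_deriv (Abs_fps w'))"
    by (simp add: c algebra_simps)
  also have "\<dots> = Abs_fps c * (?P w + ?P w')"
    by (simp add: newton_fps assms c algebra_simps)
  finally have eq: "fps_X * fps_deriv (Abs_fps c) = Abs_fps c * (?P w + ?P w')" .
  have "npow c n = npow w n + npow w' n"
  proof (rule npow_unique)
    show "c 0 = 1" using assms by (simp add: c_def)
    fix n :: nat assume "n > 0"
    have "of_nat n * c n = (fps_X * fps_deriv (Abs_fps c)) $ n" by (cases n) auto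
    also have "\<dots> = (\<Sum>i\<in>{0..n}. c i * ((-1) ^ (n - i + 1) * (npow w (n - i) + npow w' (n - i))))"
      unfolding eq by (simp add: fps_mult_nth algebra_simps sum_subtractf sum_negf)
    also have "\<dots> = (\<Sum>i<n. c i * ((-1) ^ (n - i + 1) * (npow w (n - i) + npow w' (n - i))))"
      by (intro sum.mono_neutral_right) auto
    finally show "of_nat n * c n
      = (\<Sum>i<n. c i * ((-1) ^ (n - i + 1) * (npow w (n - i) + npow w' (n - i))))" .
  qed (use False in simp)
  then show ?thesis by (simp add: c_def)
qed simp

lemma npow_line:
  assumes "w 0 = 1" "\<And>i. i \<ge> 2 \<Longrightarrow> w i = 0" "n > 0"
  shows "npow w n = w 1 ^ n"
  using \<open>n > 0\<close>
proof (induction n rule: less_induct)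
  case (less n)
  show ?case
  proof (cases "n = 1")
    case True
    then show ?thesis by (simp add: npow.simps)
  next
    case False
    then have n: "n \<ge> 2" using less.prems by simp
    have "(\<Sum>i\<in>{1..<n}. (-1) ^ (i + 1) * w i * npow w (n - i))
        = (\<Sum>i\<in>{1}. (-1) ^ (i + 1) * w i * npow w (n - i))"
      using n assms(2) by (intro sum.mono_neutral_right) auto
    then have "npow w n = w 1 * npow w (n - 1)"
      using n assms(2) by (subst npow.simps) simp
    with less.IH[of "n - 1"] n show ?thesis by (cases n) auto
  qed
qed

lemma npow_inject:
  fixes w w' :: "nat \<Rightarrow> 'a::field_char_0"
  assumes "w 0 = 1" "w' 0 = 1" "\<And>n. n > 0 \<Longrightarrow> npow w n = npow w' n"
  shows "w n = w' n"
proof (induction n rule: less_induct)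
  case (less n)
  have "of_nat n * w n = of_nat n * w' n"
    using less assms by (simp add: newton_recurrence[of w] newton_recurrence[of w'])
  then show ?case using assms by (cases "n = 0") auto
qed

lemma esym_0 [simp]: "finite I \<Longrightarrow> esym 0 I f = 1"
proof -
  assume "finite I"
  then have "{S. S \<subseteq> I \<and> card S = 0} = {{}}" by (auto dest: finite_subset)
  then show ?thesis by (simp add: esym_def)
qed

lemma esym_insert:
  assumes "finite I" "a \<notin> I"
  shows "esym (Suc n) (insert a I) f = esym (Suc n) I f + f a * esym n I f"
proof -
  let ?A = "\<lambda>n. {S. S \<subseteq> I \<and> card S = n}"
  have eq: "{S. S \<subseteq> insert a I \<and> card S = Suc n} = ?A (Suc n) \<union> insert a ` ?A n"
  proof (intro equalityI subsetI)
    fix S assume S: "S \<in> {S. S \<subseteq> insert a I \<and> card S = Suc n}"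
    then have fin: "finite S" using card_ge_0_finite by force
    show "S \<in> ?A (Suc n) \<union> insert a ` ?A n"
    proof (cases "a \<in> S")
      case True
      then have "S = insert a (S - {a})" "S - {a} \<in> ?A n" using S fin by auto
      then show ?thesis by blast
    next
      case False
      then show ?thesis using S by auto
    qed
  next
    fix S assume "S \<in> ?A (Suc n) \<union> insert a ` ?A n"
    then show "S \<in> {S. S \<subseteq> insert a I \<and> card S = Suc n}"
    proof
      assume "S \<in> insert a ` ?A n"
      then obtain T where T: "S = insert a T" "T \<subseteq> I" "card T = n" by auto
      then have "finite T" "a \<notin> T" using assms by (auto dest: finite_subset)
      then show ?thesis using T by auto
    qed auto
  qed
  have inj: "inj_on (insert a) (?A n)"
    using assms(2) by (intro inj_onI) (auto simp: insert_eq_iff subset_iff)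
  have "esym (Suc n) (insert a I) f
      = esym (Suc n) I f + (\<Sum>S\<in>insert a ` ?A n. \<Prod>i\<in>S. f i)"
    unfolding esym_def eq using assms by (intro sum.union_disjoint) auto
  also have "(\<Sum>S\<in>insert a ` ?A n. \<Prod>i\<in>S. f i) = (\<Sum>S\<in>?A n. \<Prod>i\<in>insert a S. f i)"
    by (simp add: sum.reindex[OF inj] comp_def)
  also have "\<dots> = (\<Sum>S\<in>?A n. f a * (\<Prod>i\<in>S. f i))"
  proof (rule sum.cong[OF refl])
    fix S assume "S \<in> ?A n"
    then have "finite S" "a \<notin> S" using assms by (auto dest: finite_subset)
    then show "(\<Prod>i\<in>insert a S. f i) = f a * (\<Prod>i\<in>S. f i)" by simp
  qed
  finally show ?thesis by (simp add: esym_def sum_distrib_left)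
qed

lemma esym_empty: "esym n {} f = (if n = 0 then 1 else 0)"
proof (cases "n = 0")
  case False
  then have eq: "{S. S \<subseteq> {} \<and> card S = n} = {}" by auto
  show ?thesis unfolding esym_def eq using False by simp
qed simp

lemma esym_full: "finite I \<Longrightarrow> esym (card I) I f = prod f I"
proof -
  assume "finite I"
  then have "{S. S \<subseteq> I \<and> card S = card I} = {I}" by (auto dest: card_subset_eq)
  then show ?thesis by (simp add: esym_def)
qed

lemma esym_1: "finite I \<Longrightarrow> esym (Suc 0) I f = sum f I"
  by (induction I rule: finite_induct) (auto simp: esym_insert esym_empty add.commute)

lemma npow_esym:
  assumes "finite I" "n > 0"
  shows "npow (\<lambda>i. esym i I f) n = (\<Sum>i\<in>I. f i ^ n)"
  using assms
proof (induction I rule: finite_induct)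
  case empty
  have "npow (\<lambda>i. esym i {} f) n = esym 1 {} f ^ n"
    using empty by (intro npow_line) (auto simp: esym_empty)
  then show ?case using empty by (simp add: esym_empty zero_power)
next
  case (insert a I)
  \<comment> \<open>The coefficients of 1 + f(a) X, the factor by which adjoining \<open>a\<close>
    multiplies the generating series.\<close>
  define u where "u = (\<lambda>i::nat. if i = 0 then 1 else if i = 1 then f a else 0)"
  have conv: "(\<Sum>i\<le>k. u i * esym (k - i) I f) = esym k (insert a I) f" for k
  proof (cases k)
    case 0
    then show ?thesis using insert by (simp add: u_def)
  next
    case (Suc j)
    have "(\<Sum>i\<le>k. u i * esym (k - i) I f) = (\<Sum>i\<in>{0, 1}. u i * esym (k - i) I f)"
      using Suc by (intro sum.mono_neutral_right) (auto simp: u_def)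
    then show ?thesis using Suc insert by (simp add: esym_insert u_def)
  qed
  have "npow (\<lambda>k. \<Sum>i\<le>k. u i * esym (k - i) I f) n = npow u n + npow (\<lambda>i. esym i I f) n"
    by (rule npow_convolution) (use insert in \<open>auto simp: u_def\<close>)
  moreover have "npow u n = u 1 ^ n"
    using insert by (intro npow_line) (auto simp: u_def)
  ultimately show ?case using insert by (simp add: conv) (simp add: u_def)
qed

lemma unital_hom_prod:
  assumes "unital_hom f" shows "f (prod g A) = (\<Prod>i\<in>A. f (g i))"
  using assms by (induction A rule: infinite_finite_induct) (auto simp: unital_hom_def)

lemma unital_hom_esym:
  assumes "unital_hom f" shows "f (esym n I g) = esym n I (\<lambda>i. f (g i))"
  by (simp add: esym_def unital_hom_sum[OF assms] unital_hom_prod[OF assms])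

lemma unital_hom_npow:
  assumes "unital_hom f" shows "f (npow w n) = npow (\<lambda>i. f (w i)) n"
  using unital_hom_peval[OF assms, of w "newtonp n"] by simp

section \<open>The ring of integer polynomial functions\<close>

text \<open>A model of the polynomial ring over the integers: equality is equality at rational
  points, so expressions of the same polynomial are identified, while divisibility by an integer
  still means divisibility of the coefficients.\<close>

typedef 'v zpoly = "{f :: ('v \<Rightarrow> rat) \<Rightarrow> rat. \<exists>p. f = (\<lambda>w. peval w p)}"
  morphisms zev Abs_zpoly
  by blast

setup_lifting type_definition_zpoly

lift_definition zof :: "'v ipoly \<Rightarrow> 'v zpoly" is "\<lambda>p w. peval w p"
  by blast

instantiation zpoly :: (type) comm_ring_1
begin

lift_definition zero_zpoly :: "'a zpoly" is "\<lambda>w. 0"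
  by (auto intro!: exI[of _ "PConst 0"])

lift_definition one_zpoly :: "'a zpoly" is "\<lambda>w. 1"
  by (auto intro!: exI[of _ "PConst 1"])

lift_definition plus_zpoly :: "'a zpoly \<Rightarrow> 'a zpoly \<Rightarrow> 'a zpoly" is "\<lambda>f g w. f w + g w"
  by (auto, rule_tac x = "PAdd p pa" in exI) simp

lift_definition times_zpoly :: "'a zpoly \<Rightarrow> 'a zpoly \<Rightarrow> 'a zpoly" is "\<lambda>f g w. f w * g w"
  by (auto, rule_tac x = "PMul p pa" in exI) simp

lift_definition uminus_zpoly :: "'a zpoly \<Rightarrow> 'a zpoly" is "\<lambda>f w. - f w"
  by (auto, rule_tac x = "PMul (PConst (-1)) p" in exI) simp

lift_definition minus_zpoly :: "'a zpoly \<Rightarrow> 'a zpoly \<Rightarrow> 'a zpoly" is "\<lambda>f g w. f w - g w"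
  by (auto, rule_tac x = "PAdd p (PMul (PConst (-1)) pa)" in exI) simp

instance
  by standard (transfer; simp add: algebra_simps fun_eq_iff)+

end

lemma zpoly_eqI: "(\<And>w. zev f w = zev g w) \<Longrightarrow> f = g"
  by (metis zev_inject ext)

lemma unital_hom_zev: "unital_hom (\<lambda>f. zev f w)"
  by (simp add: unital_hom_def one_zpoly.rep_eq plus_zpoly.rep_eq times_zpoly.rep_eq)

lemma zev_simps [simp]:
  "zev 0 w = 0" "zev 1 w = 1" "zev (f + g) w = zev f w + zev g w" "zev (f * g) w = zev f w * zev g w"
  "zev (- f) w = - zev f w" "zev (f - g) w = zev f w - zev g w"
  "zev (of_int c) w = of_int c" "zev (of_nat n) w = of_nat n" "zev (f ^ n) w = zev f w ^ n"
  "zev (sum h A) w = (\<Sum>i\<in>A. zev (h i) w)" "zev (prod h A) w = (\<Prod>i\<in>A. zev (h i) w)"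
  "zev (esym n A h) w = esym n A (\<lambda>i. zev (h i) w)" "zev (zof p) w = peval w p"
  "zev (npow s n) w = npow (\<lambda>i. zev (s i) w) n" "zev (peval r q) w = peval (\<lambda>i. zev (r i) w) q"
proof -
  note hom = unital_hom_zev[of w]
  show "zev 0 w = 0" "zev 1 w = 1" "zev (f + g) w = zev f w + zev g w"
    "zev (f * g) w = zev f w * zev g w" "zev (- f) w = - zev f w" "zev (f - g) w = zev f w - zev g w"
    "zev (zof p) w = peval w p"
    by (simp_all add: zero_zpoly.rep_eq one_zpoly.rep_eq plus_zpoly.rep_eq times_zpoly.rep_eq
        uminus_zpoly.rep_eq minus_zpoly.rep_eq zof.rep_eq)
  show "zev (of_int c) w = of_int c" by (rule unital_hom_of_int[OF hom])
  show "zev (of_nat n) w = of_nat n" by (rule unital_hom_of_nat[OF hom])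
  show "zev (f ^ n) w = zev f w ^ n" by (rule unital_hom_power[OF hom])
  show "zev (sum h A) w = (\<Sum>i\<in>A. zev (h i) w)" by (rule unital_hom_sum[OF hom])
  show "zev (prod h A) w = (\<Prod>i\<in>A. zev (h i) w)" by (rule unital_hom_prod[OF hom])
  show "zev (esym n A h) w = esym n A (\<lambda>i. zev (h i) w)" by (rule unital_hom_esym[OF hom])
  show "zev (npow s n) w = npow (\<lambda>i. zev (s i) w) n" by (rule unital_hom_npow[OF hom])
  show "zev (peval r q) w = peval (\<lambda>i. zev (r i) w) q" by (rule unital_hom_peval[OF hom])
qed

definition zvar :: "'v \<Rightarrow> 'v zpoly" where
  "zvar v = zof (PVar v)"

lemma zev_zvar [simp]: "zev (zvar v) w = w v"
  by (simp add: zvar_def)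

lemma ex_ipoly: "\<exists>p. zof p = f"
proof -
  obtain p where "zev f = (\<lambda>w. peval w p)" using zev[of f] by auto
  then have "zof p = f" by (intro zpoly_eqI) simp
  then show ?thesis ..
qed

definition zexpr :: "'v zpoly \<Rightarrow> 'v ipoly" where
  "zexpr f = (SOME p. zof p = f)"

lemma zof_zexpr [simp]: "zof (zexpr f) = f"
  unfolding zexpr_def using ex_ipoly by (rule someI_ex)

lemma peval_zexpr [simp]: "peval w (zexpr f) = zev f w"
  by (metis zof_zexpr zev_simps(13))

lemma zof_eq_peval: "zof p = peval zvar p"
  by (rule zpoly_eqI) simp

definition zcomp :: "('u \<Rightarrow> 'v zpoly) \<Rightarrow> 'u zpoly \<Rightarrow> 'v zpoly" where
  "zcomp s f = peval s (zexpr f)"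

lemma zev_zcomp [simp]: "zev (zcomp s f) w = zev f (\<lambda>u. zev (s u) w)"
  by (simp add: zcomp_def)

lemma unital_hom_zcomp: "unital_hom (zcomp s)"
  by (auto simp: unital_hom_def intro!: zpoly_eqI)

lemma zcomp_dvd: "of_int D dvd f \<Longrightarrow> of_int D dvd zcomp s f"
  unfolding dvd_def using unital_hom_zcomp[of s] unital_hom_of_int[OF unital_hom_zcomp[of s], of D]
  by (metis unital_hom_def)

definition zcoef :: "'v \<Rightarrow> 'v zpoly \<Rightarrow> nat \<Rightarrow> 'v zpoly" where
  "zcoef x f k = zof (pcoef x (zexpr f) k)"

lemma zcoef_upd: "zev (zcoef x f k) (w(x := t)) = zev (zcoef x f k) w"
  by (simp add: zcoef_def)

lemma zcoef_expand:
  assumes "pdeg (zexpr f) < n"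
  shows "f = (\<Sum>k<n. zcoef x f k * zvar x ^ k)"
proof (rule zpoly_eqI)
  fix w
  have "zev f w = (\<Sum>k\<le>pdeg (zexpr f). zev (zcoef x f k) w * w x ^ k)"
    using peval_expand[of w "zexpr f" x] by (simp add: zcoef_def)
  also have "\<dots> = (\<Sum>k<n. zev (zcoef x f k) w * w x ^ k)"
    using assms by (intro sum.mono_neutral_left) (auto simp: zcoef_def pcoef_above_pdeg)
  finally show "zev f w = zev (\<Sum>k<n. zcoef x f k * zvar x ^ k) w" by simp
qed

lemma zev_zcoef_eqI:
  assumes "\<And>w t. zev f (w(x := t)) = poly (q w) t"
  shows "zev (zcoef x f k) w = coeff (q w) k"
proof -
  have "upoly x w (zexpr f) = q w"
    using assms by (simp add: poly_eq_poly_eq_iff[symmetric] poly_upoly fun_eq_iff)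
  then show ?thesis by (metis coeff_upoly zcoef_def zev_simps(13))
qed

lemma coeff_upoly_zexpr: "coeff (upoly x w (zexpr f)) k = zev (zcoef x f k) w"
  by (simp add: coeff_upoly zcoef_def)

lemma zcoef_of_int_mult: "zcoef x (of_int D * f) k = of_int D * zcoef x f k"
proof (rule zpoly_eqI)
  fix w
  have "zev (zcoef x (of_int D * f) k) w = coeff (smult (of_int D) (upoly x w (zexpr f))) k"
    by (rule zev_zcoef_eqI) (simp add: poly_upoly)
  then show "zev (zcoef x (of_int D * f) k) w = zev (of_int D * zcoef x f k) w"
    by (simp add: coeff_upoly_zexpr)
qed

lemma zcoef_zvar_mult: "zcoef x (zvar x * f) (Suc k) = zcoef x f k"
proof (rule zpoly_eqI)
  fix w
  have "zev (zcoef x (zvar x * f) (Suc k)) w = coeff (pCons 0 (upoly x w (zexpr f))) (Suc k)"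
    by (rule zev_zcoef_eqI) (simp add: poly_upoly)
  then show "zev (zcoef x (zvar x * f) (Suc k)) w = zev (zcoef x f k) w"
    by (simp add: coeff_upoly_zexpr)
qed

lemma zcoef_dvd: "of_int D dvd f \<Longrightarrow> of_int D dvd zcoef x f k"
  by (auto simp: dvd_def zcoef_of_int_mult)

lemma dvd_if_zcoef_dvd:
  assumes "\<And>k. of_int D dvd zcoef x f k" shows "of_int D dvd f"
  by (subst zcoef_expand[OF lessI, of f x]) (intro dvd_sum dvd_mult2 assms)

text \<open>Multiplication by a variable only shifts coefficients, so a variable is no zero divisor
  modulo \<open>D\<close>.\<close>

lemma dvd_zvar_mult_cancel: "of_int D dvd zvar x * f \<Longrightarrow> of_int D dvd f"
  by (rule dvd_if_zcoef_dvd[of _ x]) (metis zcoef_dvd zcoef_zvar_mult)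

lemma dvd_prod_zvar_mult_cancel:
  "finite A \<Longrightarrow> of_int D dvd (\<Prod>i\<in>A. zvar (x i)) * f \<Longrightarrow> of_int D dvd f"
  by (induction A rule: finite_induct) (auto simp: mult.assoc dest: dvd_zvar_mult_cancel)

lemma sum_lessThan_add: "(\<Sum>i<a + b. g i) = (\<Sum>i<a. g i) + (\<Sum>i<b. g (a + i :: nat))"
  for g :: "nat \<Rightarrow> 'a::comm_monoid_add"
  by (induction b) (simp_all add: add.assoc)

lemma zcoef_split:
  "\<exists>r. f = (\<Sum>i<k. zcoef x f i * zvar x ^ i) + zvar x ^ k * (zcoef x f k + zvar x * r)"
proof -
  define M where "M = Suc (pdeg (zexpr f))"
  define r where "r = (\<Sum>i<M. zcoef x f (Suc k + i) * zvar x ^ i)"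
  have "f = (\<Sum>i<Suc k + M. zcoef x f i * zvar x ^ i)"
    by (rule zcoef_expand) (simp add: M_def)
  also have "\<dots> = (\<Sum>i<k. zcoef x f i * zvar x ^ i) + zcoef x f k * zvar x ^ k
      + (\<Sum>i<M. zcoef x f (Suc k + i) * zvar x ^ (Suc k + i))"
    by (simp only: sum_lessThan_add sum.lessThan_Suc)
  also have "(\<Sum>i<M. zcoef x f (Suc k + i) * zvar x ^ (Suc k + i)) = zvar x ^ k * (zvar x * r)"
    by (simp add: r_def sum_distrib_left power_add mult_ac)
  also have "(\<Sum>i<k. zcoef x f i * zvar x ^ i) + zcoef x f k * zvar x ^ k + zvar x ^ k * (zvar x * r)
      = (\<Sum>i<k. zcoef x f i * zvar x ^ i) + zvar x ^ k * (zcoef x f k + zvar x * r)"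
    by (simp add: distrib_left mult_ac add_ac)
  finally show ?thesis by blast
qed

section \<open>Algebraic independence of the elementary symmetric polynomials\<close>

text \<open>The shift by one sends x_i to the elementary symmetric polynomial of degree i + 1.
  Variables outside the chosen block stay fixed, so two alphabets can be treated one after the
  other.\<close>

definition esubst :: "(nat \<Rightarrow> 'u) \<Rightarrow> nat \<Rightarrow> 'u \<Rightarrow> 'u zpoly" where
  "esubst x N u = (if u \<in> x ` {..<N} then esym (Suc (the_inv x u)) {..<N} (\<lambda>i. zvar (x i)) else zvar u)"

lemma esubst_var: "inj x \<Longrightarrow> i < N \<Longrightarrow> esubst x N (x i) = esym (Suc i) {..<N} (\<lambda>i. zvar (x i))"
  by (simp add: esubst_def the_inv_f_f)

text \<open>With \<open>D = 0\<close> this is the algebraic independence of the elementary symmetric polynomials,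
  with other \<open>D\<close> their independence modulo \<open>D\<close>.  Compare coefficients at powers of the last
  elementary symmetric polynomial, which is a product of variables and so can be cancelled, and
  then set the last variable to \<open>0\<close>.\<close>
lemma dvd_esubst_cancel:
  fixes x :: "nat \<Rightarrow> 'u"
  assumes "inj x" "of_int D dvd zcomp (esubst x N) f"
  shows "of_int D dvd f"
  using assms(2)
proof (induction N arbitrary: f)
  case 0
  have "zcomp (esubst x 0) f = f" by (rule zpoly_eqI) (simp add: esubst_def)
  with 0 show ?case by simp
next
  case (Suc N)
  let ?H = "zcomp (esubst x (Suc N))"
  note H = unital_hom_zcomp[of "esubst x (Suc N)"]
  have last: "?H (zvar (x N)) = (\<Prod>i<Suc N. zvar (x i))"
  proof -
    have "?H (zvar (x N)) = esubst x (Suc N) (x N)" by (rule zpoly_eqI) simp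
    also have "\<dots> = esym (card {..<Suc N}) {..<Suc N} (\<lambda>i. zvar (x i))"
      using assms(1) by (simp add: esubst_var)
    finally show ?thesis by (simp only: esym_full finite_lessThan)
  qed
  show ?case
  proof (rule dvd_if_zcoef_dvd[of _ "x N"])
    fix k
    show "of_int D dvd zcoef (x N) f k"
    proof (induction k rule: less_induct)
      case (less k)
      obtain r where r: "f = (\<Sum>i<k. zcoef (x N) f i * zvar (x N) ^ i)
          + zvar (x N) ^ k * (zcoef (x N) f k + zvar (x N) * r)" (is "f = ?S + _ * ?R")
        using zcoef_split[of f "x N" k] by blast
      \<comment> \<open>The lower coefficients are divisible by the inner induction, so
        \<open>D\<close> divides the remaining part as well.\<close>
      have "of_int D dvd ?H ?S"
        using less by (intro zcomp_dvd dvd_sum dvd_mult2) auto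
      moreover have "?H f = ?H ?S + (\<Prod>i<Suc N. zvar (x i)) ^ k * ?H ?R"
        using H unital_hom_power[OF H] last by (subst r) (simp only: unital_hom_def)
      ultimately have dvd: "of_int D dvd (\<Prod>i<Suc N. zvar (x i)) ^ k * ?H ?R"
        using Suc.prems by (simp add: dvd_add_right_iff)
      have cancel: "of_int D dvd (\<Prod>i<Suc N. zvar (x i)) ^ k * g \<Longrightarrow> of_int D dvd g" for g
      proof (induction k)
        case (Suc k)
        then have "of_int D dvd (\<Prod>i<Suc N. zvar (x i)) * ((\<Prod>i<Suc N. zvar (x i)) ^ k * g)"
          by (simp only: power_Suc mult.assoc)
        then show ?case using Suc.IH dvd_prod_zvar_mult_cancel by blast
      qed simp
      let ?Z = "zcomp (\<lambda>u. if u = x N then 0 else zvar u)"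
      have "of_int D dvd ?Z (?H ?R)" using cancel[OF dvd] by (rule zcomp_dvd)
      \<comment> \<open>Setting the last variable to 0 kills the summand with \<open>r\<close> and
        reduces the lower elementary symmetric polynomials of N + 1 variables to those of N.\<close>
      also have "?Z (?H ?R) = zcomp (esubst x N) (zcoef (x N) f k)"
      proof (rule zpoly_eqI)
        fix w :: "'u \<Rightarrow> rat"
        let ?w = "\<lambda>u. if u = x N then 0 else w u"
        have w: "(\<lambda>u. zev (if u = x N then 0 else zvar u) w) = ?w" by auto
        have 0: "zev (esubst x (Suc N) (x N)) ?w = 0"
        proof -
          have "zev (esubst x (Suc N) (x N)) ?w = zev (?H (zvar (x N))) ?w" by simp
          also have "\<dots> = 0" unfolding last by simp
          finally show ?thesis .
        qed
        have agree: "zev (esubst x (Suc N) u) ?w = zev (esubst x N u) w" if "u \<noteq> x N" for u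
        proof (cases "u \<in> x ` {..<N}")
          case True
          then obtain i where i: "u = x i" "i < N" by auto
          have eq: "{..<Suc N} = insert N {..<N}" by auto
          have "esym (Suc i) {..<Suc N} (\<lambda>j. ?w (x j)) = esym (Suc i) {..<N} (\<lambda>j. ?w (x j))"
            unfolding eq by (subst esym_insert) auto
          also have "\<dots> = esym (Suc i) {..<N} (\<lambda>j. w (x j))"
            unfolding esym_def using assms(1)
            by (intro sum.cong prod.cong) (auto simp: inj_eq subset_iff)
          finally show ?thesis using i assms(1) by (simp add: esubst_var)
        next
          case False
          then show ?thesis using that by (auto simp: esubst_def lessThan_Suc)
        qed
        have "zev (?Z (?H ?R)) w = zev (zcoef (x N) f k) (\<lambda>u. zev (esubst x (Suc N) u) ?w)"
          by (simp add: w 0)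
        \<comment> \<open>The coefficient does not involve \<open>x N\<close>, so its value there
          may be replaced by the one that \<open>esubst x N\<close> prescribes.\<close>
        also have "\<dots> = zev (zcoef (x N) f k) ((\<lambda>u. zev (esubst x (Suc N) u) ?w)(x N := zev (esubst x N (x N)) w))"
          by (simp only: zcoef_upd)
        also have "(\<lambda>u. zev (esubst x (Suc N) u) ?w)(x N := zev (esubst x N (x N)) w)
            = (\<lambda>u. zev (esubst x N u) w)"
          using agree by auto
        finally show "zev (?Z (?H ?R)) w = zev (zcomp (esubst x N) (zcoef (x N) f k)) w" by simp
      qed
      finally show ?case by (rule Suc.IH)
    qed
  qed
qed

section \<open>Splitting principle: divisibility and identities tested on elementary symmetric
  polynomials\<close>

abbreviation esyms :: "nat \<Rightarrow> (nat \<Rightarrow> 'a::comm_ring_1) \<Rightarrow> nat \<Rightarrow> 'a" where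
  "esyms N \<xi> i \<equiv> esym i {..<N} \<xi>"

text \<open>Removes a denominator: integrality in the roots implies integrality in the elementary
  symmetric polynomials. Since lambda^0 is 1 and not a free variable, the conclusion is restricted
  to points with value 1 at index 0.\<close>

lemma esym_division2:
  fixes G :: "(nat + nat) ipoly"
  assumes "\<And>N. \<exists>h. \<forall>\<xi> \<eta>. peval (case_sum (esyms N \<xi>) (esyms N \<eta>)) G = of_int D * zev h (case_sum \<xi> \<eta>)"
  shows "\<exists>G'. \<forall>w :: nat + nat \<Rightarrow> rat. w (Inl 0) = 1 \<longrightarrow> w (Inr 0) = 1 \<longrightarrow> peval w G = of_int D * peval w G'"
proof -
  \<comment> \<open>Exceeds every index in \<open>G\<close>, so that only the independent elementary
    symmetric polynomials of N variables occur.\<close>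
  define N where "N = Suc (Max (insert 0 (case_sum id id ` set_ipoly G)))"
  have N: "case_sum id id v < N" if "v \<in> set_ipoly G" for v
    using that by (auto simp: N_def less_Suc_eq_le intro!: Max_ge)
  obtain h where h: "\<And>\<xi> \<eta>. peval (case_sum (esyms N \<xi>) (esyms N \<eta>)) G = of_int D * zev h (case_sum \<xi> \<eta>)"
    using assms by blast
  define g where "g = zof (psubst (\<lambda>v. if v = Inl 0 \<or> v = Inr 0 then PConst 1 else PVar v) G)"
  let ?A = "Inl \<circ> Suc :: nat \<Rightarrow> nat + nat" and ?B = "Inr \<circ> Suc :: nat \<Rightarrow> nat + nat"
  have inj: "inj ?A" "inj ?B" by (auto simp: inj_def)
  have "zcomp (esubst ?A N) (zcomp (esubst ?B N) g)
      = of_int D * zcomp (case_sum (zvar \<circ> ?A) (zvar \<circ> ?B)) h"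
  proof (rule zpoly_eqI)
    fix w
    let ?w = "\<lambda>v. zev (esubst ?A N v) w"
    have B: "?w (?B i) = w (?B i)" for i by (auto simp: esubst_def)
    have "zev (zcomp (esubst ?A N) (zcomp (esubst ?B N) g)) w
        = peval (case_sum (esyms N (w \<circ> ?A)) (esyms N (w \<circ> ?B))) G"
      unfolding zev_zcomp g_def zev_simps peval_psubst
    proof (rule peval_cong)
      fix v assume v: "v \<in> set_ipoly G"
      show "peval (\<lambda>u. zev (esubst ?B N u) ?w) (if v = Inl 0 \<or> v = Inr 0 then PConst 1 else PVar v)
          = case_sum (esyms N (w \<circ> ?A)) (esyms N (w \<circ> ?B)) v"
      proof (cases v)
        case (Inl i)
        show ?thesis
        proof (cases i)
          case (Suc j)
          have "esubst ?B N (?A j) = zvar (?A j)" by (auto simp: esubst_def)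
          moreover have "j < N" using N[OF v] Inl Suc by simp
          ultimately show ?thesis using Inl Suc esubst_var[OF inj(1), of j N] by (simp add: comp_def)
        qed (use Inl in simp)
      next
        case (Inr i)
        show ?thesis
        proof (cases i)
          case (Suc j)
          have "j < N" using N[OF v] Inr Suc by simp
          then show ?thesis using Inr Suc esubst_var[OF inj(2), of j N] B by (simp add: comp_def)
        qed (use Inr in simp)
      qed
    qed
    also have "\<dots> = of_int D * zev h (case_sum (w \<circ> ?A) (w \<circ> ?B))" by (rule h)
    also have "case_sum (w \<circ> ?A) (w \<circ> ?B) = (\<lambda>v. zev (case_sum (zvar \<circ> ?A) (zvar \<circ> ?B) v) w)"
      by (auto simp: fun_eq_iff split: sum.split)
    finally show "zev (zcomp (esubst ?A N) (zcomp (esubst ?B N) g)) w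
        = zev (of_int D * zcomp (case_sum (zvar \<circ> ?A) (zvar \<circ> ?B)) h) w"
      by (simp only: zev_simps zev_zcomp)
  qed
  then have "of_int D dvd zcomp (esubst ?A N) (zcomp (esubst ?B N) g)" by simp
  then have "of_int D dvd g" using inj by (meson dvd_esubst_cancel)
  then obtain g' where g': "g = of_int D * g'" ..
  have "peval w G = of_int D * peval w (zexpr g')" if "w (Inl 0) = 1" "w (Inr 0) = 1" for w :: "nat + nat \<Rightarrow> rat"
  proof -
    have "peval w G = zev g w"
      unfolding g_def zev_simps peval_psubst using that by (intro peval_cong) auto
    then show ?thesis by (simp add: g')
  qed
  then show ?thesis by blast
qed

lemma esym_division1:
  fixes G :: "nat ipoly"
  assumes "\<And>N. \<exists>h. \<forall>\<xi>. peval (esyms N \<xi>) G = of_int D * zev h \<xi>"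
  shows "\<exists>G'. \<forall>w :: nat \<Rightarrow> rat. w 0 = 1 \<longrightarrow> peval w G = of_int D * peval w G'"
proof -
  have "\<exists>h. \<forall>\<xi> \<eta>. peval (case_sum (esyms N \<xi>) (esyms N \<eta>)) (psubst (\<lambda>i. PVar (Inl i)) G)
      = of_int D * zev h (case_sum \<xi> \<eta> :: nat + nat \<Rightarrow> rat)" for N
  proof -
    obtain h where "\<And>\<xi>. peval (esyms N \<xi>) G = of_int D * zev h \<xi>" using assms by blast
    then show ?thesis by (intro exI[of _ "zcomp (\<lambda>i. zvar (Inl i)) h"]) simp
  qed
  from esym_division2[OF this] obtain G' where G': "w (Inl 0) = 1 \<Longrightarrow> w (Inr 0) = 1
      \<Longrightarrow> peval w (psubst (\<lambda>i. PVar (Inl i)) G) = of_int D * peval w G'" for w :: "nat + nat \<Rightarrow> rat"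
    by blast
  \<comment> \<open>Folding both blocks of variables onto one turns \<open>G'\<close> into an
    expression in a single alphabet.\<close>
  have "peval w G = of_int D * peval w (psubst (case_sum PVar PVar) G')" if "w 0 = 1" for w :: "nat \<Rightarrow> rat"
  proof -
    have "(\<lambda>v. peval w (case_sum PVar PVar v)) = case_sum w w"
      by (auto simp: fun_eq_iff split: sum.split)
    then show ?thesis using G'[of "case_sum w w"] that by simp
  qed
  then show ?thesis by blast
qed

text \<open>The division lemma with \<open>D = 0\<close> yields the identity at all rational points
  with value 1 at index 0; substituting 1 there makes it unconditional, and transfer reaches every
  ring.\<close>

lemma verification2:
  fixes p q :: "(nat + nat) ipoly" and w w' :: "nat \<Rightarrow> 'a::comm_ring_1"
  assumes "\<And>N \<xi> \<eta> :: nat \<Rightarrow> rat. peval (case_sum (esyms N \<xi>) (esyms N \<eta>)) p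
      = peval (case_sum (esyms N \<xi>) (esyms N \<eta>)) q"
    and "w 0 = 1" "w' 0 = 1"
  shows "peval (case_sum w w') p = peval (case_sum w w') q"
proof -
  define G where "G = PAdd p (PMul (PConst (-1)) q)"
  have "\<exists>G'. \<forall>w :: nat + nat \<Rightarrow> rat. w (Inl 0) = 1 \<longrightarrow> w (Inr 0) = 1 \<longrightarrow> peval w G = of_int 0 * peval w G'"
    by (rule esym_division2) (use assms in \<open>auto simp: G_def\<close>)
  then have zero: "peval w G = 0" if "w (Inl 0) = 1" "w (Inr 0) = 1" for w :: "nat + nat \<Rightarrow> rat"
    using that by auto
  let ?s = "\<lambda>v. if v = Inl 0 \<or> v = Inr 0 then PConst 1 else PVar v"
  have "peval (case_sum w w') (psubst ?s G) = 0"
    by (rule peval_eq_0_transfer) (use zero in auto)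
  moreover have "(\<lambda>v. peval (case_sum w w') (?s v)) = case_sum w w'"
    using assms(2,3) by (auto simp: fun_eq_iff split: sum.split)
  ultimately have "peval (case_sum w w') G = 0" by simp
  then show ?thesis by (simp add: G_def)
qed

lemma verification1:
  fixes p q :: "nat ipoly" and w :: "nat \<Rightarrow> 'a::comm_ring_1"
  assumes "\<And>N \<xi> :: nat \<Rightarrow> rat. peval (esyms N \<xi>) p = peval (esyms N \<xi>) q" and "w 0 = 1"
  shows "peval w p = peval w q"
  using verification2[of "psubst (\<lambda>i. PVar (Inl i)) p" "psubst (\<lambda>i. PVar (Inl i)) q" w w] assms
  by simp

section \<open>The universal polynomials of a lambda-ring\<close>

text \<open>n! e_n is (n-1)! times n e_n, and Newton's recurrence expresses n e_n by lower e_i,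
  whose denominators i! divide (n-1)!.\<close>

lemma ex_fact_esym:
  "\<exists>E :: nat ipoly. \<forall>w :: nat \<Rightarrow> rat. w 0 = 1 \<longrightarrow> fact n * w n = peval (npow w) E"
proof (induction n rule: less_induct)
  case (less n)
  then obtain E :: "nat \<Rightarrow> nat ipoly"
    where E: "\<And>i w :: nat \<Rightarrow> rat. i < n \<Longrightarrow> w 0 = 1 \<Longrightarrow> fact i * w i = peval (npow w) (E i)"
    by metis
  show ?case
  proof (cases n)
    case 0
    then show ?thesis by (intro exI[of _ "PConst 1"]) simp
  next
    case (Suc k)
    let ?c = "\<lambda>i. int (fact k div fact i) * (-1) ^ (n - i + 1)"
    have "fact n * w n = peval (npow w)
        (psum (map (\<lambda>i. PMul (PMul (PConst (?c i)) (PVar (n - i))) (E i)) [0..<n]))"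
      if "w 0 = 1" for w :: "nat \<Rightarrow> rat"
    proof -
      have "fact n * w n = fact k * (of_nat n * w n)"
        using Suc by simp
      also have "\<dots> = (\<Sum>i<n. fact k * (w i * ((-1) ^ (n - i + 1) * npow w (n - i))))"
        by (simp only: newton_recurrence[of w, OF that] sum_distrib_left)
      also have "\<dots> = (\<Sum>i<n. of_int (?c i) * npow w (n - i) * peval (npow w) (E i))"
      proof (rule sum.cong[OF refl])
        fix i assume i: "i \<in> {..<n}"
        then have "(fact i :: nat) dvd fact k" using Suc by (intro fact_dvd) simp
        then have "(of_nat (fact k div fact i) :: rat) * fact i = fact k"
          by (metis dvd_div_mult_self of_nat_fact of_nat_mult)
        then have "fact k * w i = of_nat (fact k div fact i) * peval (npow w) (E i)"
          using E[of i w] i that by (metis lessThan_iff mult.assoc)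
        then show "fact k * (w i * ((-1) ^ (n - i + 1) * npow w (n - i)))
            = of_int (?c i) * npow w (n - i) * peval (npow w) (E i)"
          by (simp add: mult_ac)
      qed
      finally show ?thesis
        by (simp add: comp_def sum_list_distinct_conv_sum_set atLeast0LessThan)
    qed
    then show ?thesis by blast
  qed
qed

lemma peval_npow_cong:
  fixes a b :: "nat \<Rightarrow> 'a::comm_ring_1"
  assumes "\<And>i. i > 0 \<Longrightarrow> a i = b i" "a 0 = b 0"
  shows "peval a p = peval b p"
proof (rule peval_cong)
  show "a v = b v" for v using assms by (cases "v = 0") auto
qed

text \<open>The power sums of the products of roots are products of power sums. This gives n! times
  the wanted polynomial, and \<open>esym_division2\<close> removes the factor.\<close>

lemma ex_lamP:
  "\<exists>e. \<forall>N \<xi> \<eta>. peval (case_sum (esyms N \<xi>) (esyms N \<eta>)) e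
     = esym n ({..<N} \<times> {..<N}) (\<lambda>(i,j). \<xi> i * \<eta> j :: rat)"
proof -
  obtain E where E: "\<And>w :: nat \<Rightarrow> rat. w 0 = 1 \<Longrightarrow> fact n * w n = peval (npow w) E"
    using ex_fact_esym by metis
  define G where "G = psubst (\<lambda>i. PMul (psubst (\<lambda>j. PVar (Inl j)) (newtonp i))
    (psubst (\<lambda>j. PVar (Inr j)) (newtonp i))) E"
  have G: "peval (case_sum (esyms N \<xi>) (esyms N \<eta>)) G
      = of_int (fact n) * esym n ({..<N} \<times> {..<N}) (\<lambda>(i,j). \<xi> i * \<eta> j)" for N and \<xi> \<eta> :: "nat \<Rightarrow> rat"
  proof -
    let ?w = "\<lambda>k. esym k ({..<N} \<times> {..<N}) (\<lambda>(i,j). \<xi> i * \<eta> j)"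
    have "peval (case_sum (esyms N \<xi>) (esyms N \<eta>)) G
        = peval (\<lambda>i. npow (esyms N \<xi>) i * npow (esyms N \<eta>) i) E"
      by (simp add: G_def)
    also have "\<dots> = peval (npow ?w) E"
    proof (rule peval_npow_cong)
      fix k :: nat assume k: "k > 0"
      then show "npow (esyms N \<xi>) k * npow (esyms N \<eta>) k = npow ?w k"
        by (simp add: npow_esym case_prod_unfold power_mult_distrib sum_product sum.cartesian_product)
    qed simp
    also have "\<dots> = fact n * ?w n" by (subst E) simp_all
    finally show ?thesis by simp
  qed
  have "\<exists>h. \<forall>\<xi> \<eta>. peval (case_sum (esyms N \<xi>) (esyms N \<eta>)) G = of_int (fact n) * zev h (case_sum \<xi> \<eta>)" for N
    unfolding G
    by (rule exI[of _ "esym n ({..<N} \<times> {..<N}) (\<lambda>(i,j). zvar (Inl i) * zvar (Inr j))"])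
      (simp add: case_prod_unfold)
  from esym_division2[OF this] obtain G' where G': "w (Inl 0) = 1 \<Longrightarrow> w (Inr 0) = 1
      \<Longrightarrow> peval w G = of_int (fact n) * peval w G'" for w :: "nat + nat \<Rightarrow> rat"
    by blast
  have "peval (case_sum (esyms N \<xi>) (esyms N \<eta>)) G' = esym n ({..<N} \<times> {..<N}) (\<lambda>(i,j). \<xi> i * \<eta> j)"
    for N and \<xi> \<eta> :: "nat \<Rightarrow> rat"
    using G[of N \<xi> \<eta>] G'[of "case_sum (esyms N \<xi>) (esyms N \<eta>)"] by simp
  then show ?thesis by blast
qed

text \<open>The pattern of the one-alphabet cases: once the power sums of a family are polynomials
  in the e_i, only a factor n! is in the way, and it can be removed because the family is integral
  in the roots.\<close>

lemma ex_symmetric_poly: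
  fixes w :: "nat \<Rightarrow> (nat \<Rightarrow> rat) \<Rightarrow> nat \<Rightarrow> rat"
  assumes "\<And>N \<xi> k. k > 0 \<Longrightarrow> npow (w N \<xi>) k = peval (esyms N \<xi>) (g k)"
    and "\<And>N \<xi>. w N \<xi> 0 = 1"
    and "\<And>N. \<exists>h. \<forall>\<xi>. w N \<xi> n = zev h \<xi>"
  shows "\<exists>e. \<forall>N \<xi>. peval (esyms N \<xi>) e = w N \<xi> n"
proof -
  obtain E where E: "\<And>w :: nat \<Rightarrow> rat. w 0 = 1 \<Longrightarrow> fact n * w n = peval (npow w) E"
    using ex_fact_esym by metis
  define G where "G = psubst (\<lambda>i. if i = 0 then PConst 0 else g i) E"
  have G: "peval (esyms N \<xi>) G = of_int (fact n) * w N \<xi> n" for N \<xi>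
  proof -
    have "peval (esyms N \<xi>) G = peval (npow (w N \<xi>)) E"
      unfolding G_def peval_psubst by (rule peval_npow_cong) (simp_all add: assms(1))
    also have "\<dots> = fact n * w N \<xi> n" by (subst E) (simp_all add: assms(2))
    finally show ?thesis by simp
  qed
  have "\<exists>h. \<forall>\<xi>. peval (esyms N \<xi>) G = of_int (fact n) * zev h \<xi>" for N
    unfolding G using assms(3) by metis
  from esym_division1[OF this] obtain G'
    where G': "w 0 = 1 \<Longrightarrow> peval w G = of_int (fact n) * peval w G'" for w :: "nat \<Rightarrow> rat"
    by blast
  have "peval (esyms N \<xi>) G' = w N \<xi> n" for N \<xi>
    using G[of N \<xi>] G'[of "esyms N \<xi>"] by simp
  then show ?thesis by blast
qed

lemma ex_esym_power:
  assumes "k > 0"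
  shows "\<exists>e. \<forall>N \<xi>. peval (esyms N \<xi>) e = esyms N (\<lambda>j. \<xi> j ^ k :: rat) i"
proof (rule ex_symmetric_poly[where w = "\<lambda>N \<xi>. esyms N (\<lambda>j. \<xi> j ^ k)" and n = i])
  show "npow (esyms N (\<lambda>j. \<xi> j ^ k)) l = peval (esyms N \<xi>) (newtonp (k * l))" if "l > 0"
    for N l and \<xi> :: "nat \<Rightarrow> rat"
    using that assms by (simp add: npow_esym power_mult)
  show "\<exists>h. \<forall>\<xi>. esyms N (\<lambda>j. \<xi> j ^ k) i = zev h \<xi>" for N
    by (rule exI[of _ "esyms N (\<lambda>j. zvar j ^ k) i"]) simp
qed simp

text \<open>The l-th power sum of the products over k-subsets is e_k of the l-th powers of the
  roots, so \<open>ex_esym_power\<close> provides the input.\<close>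

lemma ex_lamPP:
  "\<exists>e. \<forall>N \<xi>. peval (esyms N \<xi>) e
     = esym n {T. T \<subseteq> {..<N} \<and> card T = k} (\<lambda>T. \<Prod>i\<in>T. \<xi> i :: rat)"
proof -
  have "\<exists>e. l > 0 \<longrightarrow> (\<forall>N \<xi>. peval (esyms N \<xi>) e = esyms N (\<lambda>j. \<xi> j ^ l :: rat) k)" for l
    using ex_esym_power by blast
  then obtain g where g: "\<And>l N \<xi>. l > 0 \<Longrightarrow> peval (esyms N \<xi>) (g l) = esyms N (\<lambda>j. \<xi> j ^ l :: rat) k"
    by metis
  show ?thesis
  proof (rule ex_symmetric_poly[where n = n
        and w = "\<lambda>N \<xi> n. esym n {T. T \<subseteq> {..<N} \<and> card T = k} (\<lambda>T. \<Prod>i\<in>T. \<xi> i)"])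
    show "npow (\<lambda>n. esym n {T. T \<subseteq> {..<N} \<and> card T = k} (\<lambda>T. \<Prod>i\<in>T. \<xi> i)) l = peval (esyms N \<xi>) (g l)"
      if "l > 0" for N l and \<xi> :: "nat \<Rightarrow> rat"
      using that by (simp add: npow_esym g) (simp add: esym_def prod_power_distrib)
    show "\<exists>h. \<forall>\<xi>. esym n {T. T \<subseteq> {..<N} \<and> card T = k} (\<lambda>T. \<Prod>i\<in>T. \<xi> i) = zev h \<xi>" for N
      by (rule exI[of _ "esym n {T. T \<subseteq> {..<N} \<and> card T = k} (\<lambda>T. \<Prod>i\<in>T. zvar i)"]) simp
  qed simp
qed

lemma peval_lamP:
  "peval (case_sum (esyms N \<xi>) (esyms N \<eta>)) (lamP n)
     = esym n ({..<N} \<times> {..<N}) (\<lambda>(i,j). \<xi> i * \<eta> j :: rat)"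
  using someI_ex[OF ex_lamP[of n]] unfolding lamP_def by blast

lemma peval_lamPP:
  "peval (esyms N \<xi>) (lamPP n k)
     = esym n {T. T \<subseteq> {..<N} \<and> card T = k} (\<lambda>T. \<Prod>i\<in>T. \<xi> i :: rat)"
  using someI_ex[OF ex_lamPP[of n k]] unfolding lamPP_def by blast

lemma npow_lamP:
  fixes w w' :: "nat \<Rightarrow> 'a::comm_ring_1"
  assumes "w 0 = 1" "w' 0 = 1"
  shows "npow (\<lambda>n. peval (case_sum w w') (lamP n)) k = npow w k * npow w' k"
proof (cases "k = 0")
  case False
  have "peval (case_sum w w') (psubst lamP (newtonp k)) = peval (case_sum w w')
      (PMul (psubst (\<lambda>j. PVar (Inl j)) (newtonp k)) (psubst (\<lambda>j. PVar (Inr j)) (newtonp k)))"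
    by (rule verification2) (use assms False in \<open>simp_all add: peval_lamP npow_esym
      case_prod_unfold power_mult_distrib sum_product sum.cartesian_product\<close>)
  then show ?thesis by simp
qed simp

lemma lamP_0: "w 0 = 1 \<Longrightarrow> w' 0 = 1 \<Longrightarrow> peval (case_sum w w') (lamP 0) = 1"
  using verification2[of "lamP 0" "PConst 1" w w'] by (simp add: peval_lamP)

lemma lamPP_0: "w 0 = 1 \<Longrightarrow> peval w (lamPP 0 k) = 1"
  using verification1[of "lamPP 0 k" "PConst 1" w] by (simp add: peval_lamPP)

text \<open>The polynomial expressing \<open>\<psi>\<^sup>k(\<lambda>\<^sup>i(x))\<close> through the \<open>\<lambda>\<^sup>j(x)\<close>.\<close>
definition psilam :: "nat \<Rightarrow> nat \<Rightarrow> nat ipoly" where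
  "psilam k i = psubst (\<lambda>j. lamPP j i) (newtonp k)"

lemma peval_psilam: "peval w (psilam k i) = npow (\<lambda>j. peval w (lamPP j i)) k"
  by (simp add: psilam_def)

lemma peval_psilam_esyms:
  "k > 0 \<Longrightarrow> peval (esyms N \<xi>) (psilam k i) = esyms N (\<lambda>j. \<xi> j ^ k :: rat) i"
  by (simp add: peval_psilam peval_lamPP npow_esym) (simp add: esym_def prod_power_distrib)

text \<open>Composition of Adams operations at the level of expressions: on roots psi^k takes k-th
  powers, and the l-th power sum of these is the one of index k l.\<close>

lemma npow_psilam:
  fixes w :: "nat \<Rightarrow> 'a::comm_ring_1"
  assumes "w 0 = 1" "k > 0"
  shows "npow (\<lambda>i. peval w (psilam k i)) l = npow w (k * l)"
proof (cases "l = 0")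
  case False
  have "peval w (psubst (psilam k) (newtonp l)) = peval w (newtonp (k * l))"
    by (rule verification1) (use assms False in \<open>simp_all add: peval_psilam_esyms npow_esym power_mult\<close>)
  then show ?thesis by simp
qed simp

lemma psilam_0: "w 0 = 1 \<Longrightarrow> k > 0 \<Longrightarrow> peval w (psilam k 0) = 1"
  using verification1[of "psilam k 0" "PConst 1" w] by (simp add: peval_psilam_esyms)

lemma psilam_1:
  assumes "w 0 = 1" "k > 0"
  shows "peval w (psilam k 1) = npow w k"
  using verification1[of "psilam k 1" "newtonp k" w] assms
  by (simp add: peval_psilam_esyms esym_1 npow_esym)

lemma psilam_psilam:
  assumes "w 0 = 1" "k > 0" "l > 0"
  shows "peval (\<lambda>i. peval w (psilam k i)) (psilam l j) = peval w (psilam (k * l) j)"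
  using verification1[of "psubst (psilam k) (psilam l j)" "psilam (k * l) j" w] assms
  by (simp add: peval_psilam_esyms power_mult)

section \<open>A Dwork lemma for the ghost components of parameter \<open>m\<close>\<close>

lemma of_int_dvd_of_int_mult: "a dvd b \<Longrightarrow> (of_int a :: 'a::comm_ring_1) dvd of_int b * x"
  by (auto simp: dvd_def mult.assoc)

lemma dvd_diff_swap: "x dvd a - b \<Longrightarrow> x dvd b - a" for x :: "'a::comm_ring_1"
  by (metis dvd_minus_iff minus_diff_eq)

text \<open>Bezout's identity lives in the integers and can be applied in any commutative ring, with
  or without torsion.\<close>

lemma coprime_dvd_mult_cancel:
  fixes X :: "'a::comm_ring_1"
  assumes "coprime a b" "of_int a dvd of_int b * X"
  shows "of_int a dvd X"
proof -
  obtain u v where uv: "u * a + v * b = 1"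
    using assms(1) bezout_int[of a b] by auto
  have "of_int u * (of_int a * X) + of_int v * (of_int b * X) = of_int (u * a + v * b) * X"
    by (simp add: algebra_simps)
  then have "X = of_int u * (of_int a * X) + of_int v * (of_int b * X)" using uv by simp
  moreover have "of_int a dvd of_int u * (of_int a * X) + of_int v * (of_int b * X)"
    by (rule dvd_add) (use assms(2) in \<open>auto intro: dvd_mult\<close>)
  ultimately show ?thesis by simp
qed

lemma coprime_mult_dvd:
  fixes X :: "'a::comm_ring_1"
  assumes "coprime a b" "of_int a dvd X" "of_int b dvd X"
  shows "of_int (a * b) dvd X"
proof -
  obtain Y where Y: "X = of_int b * Y" using assms(3) ..
  then have "of_int a dvd Y" using assms by (auto intro: coprime_dvd_mult_cancel)
  then show ?thesis using Y by (auto simp: dvd_def mult_ac)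
qed

lemma prime_power_part:
  fixes n :: nat
  assumes "prime p" "n > 0"
  obtains a n' where "n = p ^ a * n'" "\<not> p dvd n'" "n' > 0"
  using prime_power_canonical[OF assms] assms(2) by (metis mult.commute mult_eq_0_iff gr0I)

lemma dvd_if_prime_powers_dvd:
  fixes X :: "'a::comm_ring_1"
  assumes "n > 0" "\<And>p j. prime p \<Longrightarrow> j > 0 \<Longrightarrow> p ^ j dvd n \<Longrightarrow> of_int (int (p ^ j)) dvd X"
  shows "of_int (int n) dvd X"
  using assms
proof (induction n rule: less_induct)
  case (less n)
  show ?case
  proof (cases "n = 1")
    case False
    then obtain p where p: "prime p" "p dvd n" using prime_factor_nat by blast
    obtain a n' where n': "n = p ^ a * n'" "\<not> p dvd n'" "n' > 0"
      using prime_power_part[OF p(1) less.prems(1)] by blast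
    have a: "a > 0" using p(2) n' by (cases a) auto
    have cop: "coprime (p ^ a) n'" using p(1) n'(2) by (simp add: prime_imp_coprime)
    have "n' < n" using n' a prime_gt_1_nat[OF p(1)] using one_less_power[of p a] by simp
    then have "of_int (int n') dvd X"
    proof (rule less.IH[OF _ n'(3)])
      fix q j assume "prime q" "j > 0" "q ^ j dvd n'"
      then show "of_int (int (q ^ j)) dvd X"
        by (intro less.prems(2)) (simp_all only: n'(1) dvd_mult)
    qed
    moreover have "of_int (int (p ^ a)) dvd X"
      using less.prems(2)[OF p(1) a] n' by simp
    ultimately have "of_int (int (p ^ a) * int n') dvd X"
      using cop by (intro coprime_mult_dvd) (simp_all flip: coprime_int_iff)
    then show ?thesis using n' by simp
  qed simp
qed

text \<open>The cofactor of a - b is a sum of p terms, each congruent to b^(p-1) modulo p, so it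
  contributes one more factor p.\<close>

lemma power_diff_dvd_step:
  fixes a b :: "'a::comm_ring_1"
  assumes "of_int D dvd a - b" "int p dvd D"
  shows "of_int (int p * D) dvd a ^ p - b ^ p"
proof -
  have p: "of_int (int p) dvd a - b"
    using of_int_dvd_of_int_mult[OF assms(2), of 1] assms(1) by (auto intro: dvd_trans)
  have pow: "a - b dvd a ^ k - b ^ k" for k
    by (simp add: power_diff_sumr2)
  have "of_int (int p) dvd (\<Sum>i<p. b ^ (p - Suc i) * a ^ i)"
  proof -
    have "(\<Sum>i<p. b ^ (p - Suc i) * a ^ i) = (\<Sum>i<p. b ^ (p - Suc i) * (a ^ i - b ^ i) + b ^ (p - 1))"
    proof (rule sum.cong[OF refl])
      fix i assume "i \<in> {..<p}"
      then have "p - 1 = (p - Suc i) + i" by auto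
      then show "b ^ (p - Suc i) * a ^ i = b ^ (p - Suc i) * (a ^ i - b ^ i) + b ^ (p - 1)"
        by (simp add: algebra_simps power_add)
    qed
    also have "\<dots> = (\<Sum>i<p. b ^ (p - Suc i) * (a ^ i - b ^ i)) + of_int (int p) * b ^ (p - 1)"
      by (simp add: sum.distrib)
    also have "of_int (int p) dvd \<dots>"
      by (rule dvd_add) (auto intro!: dvd_sum dvd_mult dvd_trans[OF _ pow] simp: p[simplified])
    finally show ?thesis .
  qed
  then have "of_int D * of_int (int p) dvd (a - b) * (\<Sum>i<p. b ^ (p - Suc i) * a ^ i)"
    using assms(1) by (intro mult_dvd_mono)
  then show ?thesis by (simp add: power_diff_sumr2 mult.commute)
qed

lemma power_diff_dvd:
  fixes a b :: "'a::comm_ring_1"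
  assumes "of_int (int p) dvd a - b"
  shows "of_int (int (p ^ Suc i)) dvd a ^ (p ^ i) - b ^ (p ^ i)"
proof (induction i)
  case (Suc i)
  have "of_int (int p * int (p ^ Suc i)) dvd (a ^ (p ^ i)) ^ p - (b ^ (p ^ i)) ^ p"
    by (rule power_diff_dvd_step) (use Suc in simp_all)
  then show ?case by (simp add: power_mult[symmetric] mult.commute)
qed (use assms in simp)

lemma freshman_dvd:
  fixes a b :: "'a::comm_ring_1"
  assumes "prime p"
  shows "of_int (int p) dvd (a + b) ^ p - (a ^ p + b ^ p)"
proof -
  have p: "p > 0" using assms by (simp add: prime_gt_0_nat)
  have "{..p} = insert 0 (insert p {1..<p})" using p by auto
  then have "(a + b) ^ p - (a ^ p + b ^ p) = (\<Sum>k\<in>{1..<p}. of_nat (p choose k) * a ^ k * b ^ (p - k))"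
    using p by (simp add: binomial_ring)
  also have "of_int (int p) dvd \<dots>"
  proof (intro dvd_sum dvd_mult2)
    fix k assume "k \<in> {1..<p}"
    then have "p dvd p choose k" using assms by (intro dvd_choose_prime) auto
    then show "of_int (int p) dvd (of_nat (p choose k) :: 'a)"
      by (auto simp: dvd_def)
  qed
  finally show ?thesis .
qed

lemma fermat_dvd:
  assumes "prime p" shows "int p dvd c - c ^ p"
proof (induction c rule: int_induct[where k = 0])
  case base
  then show ?case using assms by (simp add: zero_power prime_gt_0_nat)
next
  case (step1 i)
  have "int p dvd (i + 1) ^ p - (i ^ p + 1)" using freshman_dvd[OF assms, of i 1] by simp
  from dvd_diff[OF step1(2) this] show ?case by (simp add: algebra_simps)
next
  case (step2 i)
  have "int p dvd i ^ p - ((i - 1) ^ p + 1)" using freshman_dvd[OF assms, of "i - 1" 1] by simp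
  from dvd_add[OF step2(2) this] show ?case by (simp add: algebra_simps)
qed

lemma frobenius_dvd:
  fixes w :: "'v \<Rightarrow> 'a::comm_ring_1"
  assumes "prime p"
  shows "of_int (int p) dvd peval (\<lambda>v. w v ^ p) q - peval w q ^ p"
proof (induction q)
  case (PConst c)
  then show ?case using of_int_dvd_of_int_mult[OF fermat_dvd[OF assms, of c], of 1] by simp
next
  case (PAdd q r)
  let ?F = "\<lambda>q. peval (\<lambda>v. w v ^ p) q" and ?e = "peval w"
  have "?F (PAdd q r) - ?e (PAdd q r) ^ p
      = (?F q - ?e q ^ p) + (?F r - ?e r ^ p) - ((?e q + ?e r) ^ p - (?e q ^ p + ?e r ^ p))"
    by simp
  then show ?case using PAdd freshman_dvd[OF assms, of "?e q" "?e r"]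
    by (metis dvd_diff dvd_add)
next
  case (PMul q r)
  let ?F = "\<lambda>q. peval (\<lambda>v. w v ^ p) q" and ?e = "peval w"
  have "?F (PMul q r) - ?e (PMul q r) ^ p = (?F q - ?e q ^ p) * ?F r + ?e q ^ p * (?F r - ?e r ^ p)"
    by (simp add: algebra_simps power_mult_distrib)
  then show ?case using PMul by (metis dvd_add dvd_mult dvd_mult2)
qed simp

text \<open>x^k is a power of x^p. Raising the congruence modulo p to the exponent p^(j-1) improves
  it to one modulo p^j, and a further power keeps it.\<close>

lemma power_frobenius_dvd:
  fixes x y :: "'a::comm_ring_1"
  assumes "prime p" "k > 0" "p ^ j dvd k" "j > 0" "of_int (int p) dvd x ^ p - y"
  shows "of_int (int (p ^ j)) dvd x ^ k - y ^ (k div p)"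
proof -
  obtain i where j: "j = Suc i" using assms(4) by (cases j) auto
  obtain c where k: "k = p ^ j * c" using assms(3) by auto
  have "of_int (int (p ^ Suc i)) dvd (x ^ p) ^ (p ^ i) - y ^ (p ^ i)"
    using assms by (intro power_diff_dvd) auto
  also have "\<dots> dvd ((x ^ p) ^ (p ^ i)) ^ c - (y ^ (p ^ i)) ^ c"
    by (simp add: power_diff_sumr2)
  finally show ?thesis
    using assms(1) by (simp add: j k power_mult[symmetric] mult_ac prime_gt_0_nat)
qed

section \<open>The brackets [k]_m modulo prime powers\<close>

lemma qbr_add: "qbr m (a + b) = qbr m a + m ^ a * qbr m b"
  by (simp add: qbr_def sum_lessThan_add sum_distrib_left power_add)

lemma qbr_1 [simp]: "qbr m (Suc 0) = 1"
  by (simp add: qbr_def)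

lemma one_minus_mult_qbr: "(1 - m) * qbr m k = 1 - m ^ k"
proof (induction k)
  case (Suc k)
  have "qbr m (Suc k) = qbr m k + m ^ k" by (simp add: qbr_def)
  then have "(1 - m) * qbr m (Suc k) = (1 - m) * qbr m k + (1 - m) * m ^ k" by (simp add: distrib_left)
  with Suc show ?case by (simp add: algebra_simps)
qed (simp add: qbr_def)

lemma qbr_mult: "qbr m (a * b) = qbr m a * qbr (m ^ a) b"
proof (induction b)
  case (Suc b)
  have "qbr m (a * Suc b) = qbr m (a * b) + m ^ (a * b) * qbr m a"
    by (simp add: qbr_add add.commute[of a])
  also have "\<dots> = qbr m a * (qbr (m ^ a) b + (m ^ a) ^ b)"
    using Suc by (simp add: algebra_simps power_mult)
  finally show ?case by (simp add: qbr_def)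
qed (simp add: qbr_def)

text \<open>All powers of m are 1 modulo p, so a sum of p of them is 0 modulo p.\<close>

lemma prime_dvd_qbr:
  assumes "int p dvd 1 - m" shows "int p dvd qbr m p"
proof -
  have "int p dvd m ^ i - 1" for i
    using assms power_diff_sumr2[of m i 1] by (metis dvd_diff_commute dvd_mult2 power_one)
  then have "int p dvd (\<Sum>i<p. m ^ i - 1)" by (intro dvd_sum) auto
  then show ?thesis by (simp add: sum_subtractf qbr_def dvd_diff_left_iff)
qed

lemma prime_power_dvd_qbr:
  assumes "int p dvd 1 - m" shows "int (p ^ a) dvd qbr m (p ^ a * b)"
proof (induction a)
  case (Suc a)
  have "p ^ Suc a * b = (p ^ a * b) * p" by simp
  then have "qbr m (p ^ Suc a * b) = qbr m (p ^ a * b) * qbr (m ^ (p ^ a * b)) p"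
    by (simp only: qbr_mult)
  moreover have "int p dvd 1 - m ^ (p ^ a * b)"
    using assms one_minus_mult_qbr[of m "p ^ a * b"] by (metis dvd_mult2)
  ultimately show ?case
    using mult_dvd_mono[OF Suc prime_dvd_qbr[of p "m ^ (p ^ a * b)"]] by (simp add: mult_ac)
qed simp

text \<open>If \<open>f\<close> carries at least the p-part of \<open>e\<close>, replacing
  \<open>e\<close> by \<open>f\<close> in the product with \<open>d\<close> loses no power of
  p.\<close>

lemma prime_power_dvd_mult:
  assumes "prime p" "p ^ j dvd d * e" "e > (0::nat)" "\<And>a. p ^ a dvd e \<Longrightarrow> int (p ^ a) dvd f"
  shows "int (p ^ j) dvd int d * f"
proof -
  obtain a e' where e: "e = p ^ a * e'" "\<not> p dvd e'" using prime_power_part[OF assms(1,3)] by blast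
  have "coprime (p ^ j) e'" using assms(1) e by (simp add: prime_imp_coprime)
  then have "p ^ j dvd d * p ^ a"
    using assms(2) e by (metis coprime_dvd_mult_left_iff mult.assoc)
  then have "int (p ^ j) dvd int d * int (p ^ a)" by (metis int_dvd_int_iff of_nat_mult)
  also have "\<dots> dvd int d * f" using assms(4)[of a] e by (intro mult_dvd_mono) auto
  finally show ?thesis .
qed

text \<open>\<open>th k\<close> is the operation inside the ghost components, \<open>ph p\<close> an
  endomorphism playing the role of a Frobenius lift. The Witt side takes powers for
  \<open>th\<close> and the substitution of p-th powers for \<open>ph\<close>; the other side takes
  Psi- or Adams operations for both, and then the congruence is an equality.\<close>

locale ghost_setting =
  fixes m :: int and th ph :: "nat \<Rightarrow> 'a::comm_ring_1 \<Rightarrow> 'a"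
  assumes th_1: "th (Suc 0) x = x"
    and ph_hom: "prime p \<Longrightarrow> unital_hom (ph p)"
    and th_ph: "prime p \<Longrightarrow> k > 0 \<Longrightarrow> p ^ j dvd k \<Longrightarrow> j > 0 \<Longrightarrow>
      of_int (int (p ^ j)) dvd th k x - ph p (th (k div p) x)"
begin

definition ghost :: "(nat \<Rightarrow> 'a) \<Rightarrow> nat \<Rightarrow> 'a" where
  "ghost s n = (\<Sum>d | d dvd n. of_nat d * of_int (qbr m (n div d)) * th (n div d) (s d))"

text \<open>The second condition is stated after multiplication by \<open>1 - m\<close>, which turns
  \<open>[k]\<^sub>m\<close> into \<open>1 - m\<^sup>k\<close>.\<close>
definition dwork :: "(nat \<Rightarrow> 'a) \<Rightarrow> bool" where
  "dwork f \<longleftrightarrow> (\<forall>p j n. prime p \<longrightarrow> n > 0 \<longrightarrow> j > 0 \<longrightarrow> p ^ j dvd n \<longrightarrow>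
     (if int p dvd 1 - m then of_int (int (p ^ j)) dvd f n
      else of_int (int (p ^ j)) dvd of_int (1 - m) * (f n - ph p (f (n div p)))))"

lemma dworkD:
  assumes "dwork f" "prime p" "n > 0" "j > 0" "p ^ j dvd n"
  shows "int p dvd 1 - m \<Longrightarrow> of_int (int (p ^ j)) dvd f n"
    and "\<not> int p dvd 1 - m \<Longrightarrow>
      of_int (int (p ^ j)) dvd of_int (1 - m) * (f n - ph p (f (n div p)))"
  using assms unfolding dwork_def by presburger+

text \<open>If p divides 1 - m, every summand is divisible by p^j on its own. Otherwise the summands
  at n and n/p that belong to the same divisor are compared.\<close>

lemma dwork_ghost: "dwork (ghost s)"
  unfolding dwork_def
proof (intro allI impI)
  fix p j n :: nat
  assume p: "prime p" and n: "n > 0" and j: "j > 0" and pj: "p ^ j dvd n"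
  have fin: "finite {d. d dvd n}" using n by simp
  show "if int p dvd 1 - m then of_int (int (p ^ j)) dvd ghost s n
      else of_int (int (p ^ j)) dvd of_int (1 - m) * (ghost s n - ph p (ghost s (n div p)))"
  proof (cases "int p dvd 1 - m")
    case True
    have "of_int (int (p ^ j)) dvd ghost s n"
      unfolding ghost_def
    proof (rule dvd_sum)
      fix d assume "d \<in> {d. d dvd n}"
      then have d: "n = d * (n div d)" "n div d > 0" using n by (auto elim: dvdE)
      have "int (p ^ j) dvd int d * qbr m (n div d)"
      proof (rule prime_power_dvd_mult[OF p _ d(2)])
        show "p ^ j dvd d * (n div d)" using pj d(1) by simp
        show "int (p ^ a) dvd qbr m (n div d)" if "p ^ a dvd n div d" for a
          using that prime_power_dvd_qbr[OF True] by (auto simp only: dvd_def)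
      qed
      from of_int_dvd_of_int_mult[OF this, of "th (n div d) (s d)"]
      show "of_int (int (p ^ j)) dvd of_nat d * of_int (qbr m (n div d)) * th (n div d) (s d)" by simp
    qed
    with True show ?thesis by simp
  next
    case False
    have pn: "p dvd n" using pj j by (metis dvd_power dvd_trans)
    let ?n = "n div p"
    have "?n dvd n" using pn by (metis dvd_mult_div_cancel dvd_triv_right)
    have n': "?n > 0" using pn n by (auto elim: dvdE)
    define A where "A d = of_int (int d * (1 - m ^ (n div d))) * th (n div d) (s d)" for d
    define B where "B d = of_int (int d * (1 - m ^ (?n div d))) * ph p (th (?n div d) (s d))" for d
    have c: "of_int (1 - m) * (of_nat d * of_int (qbr m k) * x) = of_int (int d * (1 - m ^ k)) * x"
      for d k and x :: 'a
      unfolding one_minus_mult_qbr[symmetric] by (simp add: mult_ac)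
    have A: "of_int (1 - m) * ghost s n = (\<Sum>d | d dvd n. A d)"
      unfolding ghost_def A_def sum_distrib_left c ..
    have "of_int (1 - m) * ph p (ghost s ?n) = ph p (of_int (1 - m) * ghost s ?n)"
      using ph_hom[OF p] unital_hom_of_int[OF ph_hom[OF p], of "1 - m"] by (simp only: unital_hom_def)
    also have "\<dots> = (\<Sum>d | d dvd ?n. ph p (of_int (int d * (1 - m ^ (?n div d))) * th (?n div d) (s d)))"
      unfolding ghost_def sum_distrib_left c by (rule unital_hom_sum[OF ph_hom[OF p]])
    also have "\<dots> = (\<Sum>d | d dvd ?n. B d)"
      unfolding B_def using ph_hom[OF p] unital_hom_of_int[OF ph_hom[OF p]]
      by (simp only: unital_hom_def)
    finally have B: "of_int (1 - m) * ph p (ghost s ?n) = (\<Sum>d | d dvd ?n. B d)" .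
    \<comment> \<open>Divisors of n/p have a partner in the ghost component at n/p; the others
      absorb the whole p-part of n.\<close>
    have split: "{d. d dvd n} = {d. d dvd ?n} \<union> {d. d dvd n \<and> \<not> d dvd ?n}"
      using dvd_trans[OF _ \<open>?n dvd n\<close>] by auto
    have "(\<Sum>d | d dvd n. A d) = (\<Sum>d | d dvd ?n. A d) + (\<Sum>d | d dvd n \<and> \<not> d dvd ?n. A d)"
      using fin n' by (subst split, intro sum.union_disjoint) auto
    then have "of_int (1 - m) * (ghost s n - ph p (ghost s ?n))
        = (\<Sum>d | d dvd ?n. A d - B d) + (\<Sum>d | d dvd n \<and> \<not> d dvd ?n. A d)"
      unfolding right_diff_distrib A B sum_subtractf by simp
    also have "of_int (int (p ^ j)) dvd \<dots>"
    proof (rule dvd_add; rule dvd_sum)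
      fix d assume "d \<in> {d. d dvd ?n}"
      then obtain e where e: "?n = d * e" by (auto elim: dvdE)
      then have d: "d > 0" "e > 0" using n' by auto
      have ne: "n = d * (p * e)" using e pn by (metis dvd_mult_div_cancel mult.left_commute)
      have de: "?n div d = e" "n div d = p * e" using d e ne by simp_all
      obtain a e' where ae: "p * e = p ^ a * e'" "\<not> p dvd e'" "e' > 0"
        using prime_power_part[OF p, of "p * e"] d prime_gt_0_nat[OF p] by (metis nat_0_less_mult_iff)
      have a: "a > 0" using ae by (cases a) (auto dest: sym)
      have "coprime (p ^ j) e'" using p ae by (simp add: prime_imp_coprime)
      then have "p ^ j dvd d * p ^ a"
        using pj ne ae by (metis coprime_dvd_mult_left_iff mult.assoc)
      then obtain k where "d * p ^ a = p ^ j * k" ..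
      then have "(of_nat d :: 'a) * of_int (int (p ^ a)) = of_int (int (p ^ j)) * of_nat k"
        by (metis of_nat_mult of_int_of_nat_eq)
      then have dvd1: "of_int (int (p ^ j)) dvd (of_nat d :: 'a) * of_int (int (p ^ a))" by simp
      have "int (p ^ a) dvd m ^ (p * e) - m ^ (p * e div p)"
        using power_frobenius_dvd[of p "p * e" a m m] p d a ae dvd_diff_swap[OF fermat_dvd[OF p, of m]]
          prime_gt_0_nat[OF p] by simp
      from dvd_diff_swap[OF this] have dm: "int (p ^ a) dvd m ^ e - m ^ (p * e)"
        using prime_gt_0_nat[OF p] by simp
      have "of_int (int (p ^ a)) dvd th (p * e) (s d) - ph p (th (p * e div p) (s d))"
        using p d a ae prime_gt_0_nat[OF p] by (intro th_ph) auto
      then have dt: "of_int (int (p ^ a)) dvd th (p * e) (s d) - ph p (th e (s d))"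
        using prime_gt_0_nat[OF p] by simp
      let ?x = "th (p * e) (s d)" and ?y = "ph p (th e (s d))"
      \<comment> \<open>Coefficient and operation are exchanged separately: Fermat's congruence
        identifies m^(pe) with m^e modulo p^a, \<open>th_ph\<close> does the same for the
        operations, and \<open>d\<close> supplies the missing power of p.\<close>
      have "A d - B d = of_nat d * (of_int (1 - m ^ (p * e)) * (?x - ?y) + of_int (m ^ e - m ^ (p * e)) * ?y)"
        by (simp add: A_def B_def de algebra_simps)
      also have "of_nat d * of_int (int (p ^ a)) dvd \<dots>"
        by (intro mult_dvd_mono dvd_refl dvd_add dvd_mult dt of_int_dvd_of_int_mult dm)
      finally show "of_int (int (p ^ j)) dvd A d - B d" using dvd1 dvd_trans by blast
    next
      fix d assume d: "d \<in> {d. d dvd n \<and> \<not> d dvd ?n}"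
      then obtain e where e: "n = d * e" by (auto elim: dvdE)
      have "\<not> p dvd e"
      proof
        assume "p dvd e"
        then obtain c where "e = p * c" ..
        then have "?n = d * c" using e prime_gt_0_nat[OF p] by simp
        with d show False by simp
      qed
      then have "coprime (p ^ j) e" using p by (simp add: prime_imp_coprime)
      then have "p ^ j dvd d" using pj e by (metis coprime_dvd_mult_left_iff)
      then have "int (p ^ j) dvd int d * (1 - m ^ (n div d))" by (metis dvd_mult2 int_dvd_int_iff)
      then show "of_int (int (p ^ j)) dvd A d"
        unfolding A_def by (rule of_int_dvd_of_int_mult)
    qed
    finally show ?thesis using False by simp
  qed
qed

lemma ghost_cong: "(\<And>d. d dvd n \<Longrightarrow> s d = t d) \<Longrightarrow> ghost s n = ghost t n"
  by (simp add: ghost_def)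

lemma ghost_upd:
  assumes "n > 0" shows "ghost (s(n := r)) n = ghost (s(n := 0)) n + of_nat n * r"
proof -
  have split: "{d. d dvd n} = insert n {d. d dvd n \<and> d \<noteq> n}" by auto
  have fin: "finite {d. d dvd n \<and> d \<noteq> n}" using assms by simp
  have "ghost (s(n := r)) n = of_nat n * r
      + (\<Sum>d | d dvd n \<and> d \<noteq> n. of_nat d * of_int (qbr m (n div d)) * th (n div d) (s d))" for r
    unfolding ghost_def by (subst split, subst sum.insert) (use fin assms th_1 in auto)
  then show ?thesis by simp
qed

text \<open>The component s_n comes from dividing by n the difference between f n and the
  contribution of the proper divisors. Both sequences satisfy the Dwork congruences and agree at
  n/p, so their difference at n vanishes modulo every prime power dividing n.\<close>

lemma dwork_imp_ghost:
  assumes "dwork f"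
  shows "\<exists>s. \<forall>n>0. f n = ghost s n"
proof -
  \<comment> \<open>The update by the value already present prepares dependent choice: the property
    must make sense for a candidate \<open>r\<close> in place of s_n and depend on earlier
    components only.\<close>
  have "\<exists>s. \<forall>n. n > 0 \<longrightarrow> f n = ghost (s(n := s n)) n"
  proof (rule dependent_wellorder_choice[where P = "\<lambda>s n r. n > 0 \<longrightarrow> f n = ghost (s(n := r)) n"])
    fix r :: 'a and s t :: "nat \<Rightarrow> 'a" and n :: nat
    assume eq: "\<And>y. y < n \<Longrightarrow> s y = t y"
    have "ghost (s(n := r)) n = ghost (t(n := r)) n" if "n > 0"
    proof (rule ghost_cong)
      fix d assume "d dvd n"
      then have "d \<le> n" using that by (rule dvd_imp_le)
      then show "(s(n := r)) d = (t(n := r)) d" using eq by (cases "d = n") auto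
    qed
    then show "(n > 0 \<longrightarrow> f n = ghost (s(n := r)) n) = (n > 0 \<longrightarrow> f n = ghost (t(n := r)) n)" by auto
  next
    fix n :: nat and s :: "nat \<Rightarrow> 'a"
    assume IH: "\<And>y. y < n \<Longrightarrow> y > 0 \<longrightarrow> f y = ghost (s(y := s y)) y"
    define s' where "s' = s(n := 0)"
    have f: "f y = ghost s' y" if "y < n" "y > 0" for y
    proof -
      have "f y = ghost s y" using IH that by simp
      also have "\<dots> = ghost s' y"
        using that by (intro ghost_cong) (auto simp: s'_def dest: dvd_imp_le)
      finally show ?thesis .
    qed
    show "\<exists>r. n > 0 \<longrightarrow> f n = ghost (s(n := r)) n"
    proof (cases "n > 0")
      case True
      have "of_int (int n) dvd f n - ghost s' n"
      proof (rule dvd_if_prime_powers_dvd[OF True])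
        fix p j :: nat assume pj: "prime p" "j > 0" "p ^ j dvd n"
        have pn: "p dvd n" using pj by (metis dvd_power dvd_trans)
        have "n div p < n" "n div p > 0"
          using pn True prime_gt_1_nat[OF pj(1)] by (auto elim: dvdE)
        then have eq: "f (n div p) = ghost s' (n div p)" by (rule f)
        show "of_int (int (p ^ j)) dvd f n - ghost s' n"
        proof (cases "int p dvd 1 - m")
          case True
          then show ?thesis
            using dworkD(1)[OF assms] dworkD(1)[OF dwork_ghost] pj \<open>n > 0\<close> by (intro dvd_diff)
        next
          case False
          then have "of_int (int (p ^ j)) dvd of_int (1 - m) * (f n - ph p (f (n div p)))"
            "of_int (int (p ^ j)) dvd of_int (1 - m) * (ghost s' n - ph p (ghost s' (n div p)))"
            using dworkD(2)[OF assms] dworkD(2)[OF dwork_ghost] pj \<open>n > 0\<close> by blast+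
          from dvd_diff[OF this] have "of_int (int (p ^ j)) dvd of_int (1 - m) * (f n - ghost s' n)"
            by (simp add: eq algebra_simps)
          moreover have "coprime (int (p ^ j)) (1 - m)"
            using False pj(1) by (simp add: prime_imp_coprime)
          ultimately show ?thesis using coprime_dvd_mult_cancel by blast
        qed
      qed
      then obtain r where "f n - ghost s' n = of_int (int n) * r" ..
      then have "f n = ghost s' n + of_nat n * r" by (simp add: algebra_simps)
      then show ?thesis using ghost_upd[OF True, of s r] by (intro exI[of _ r]) (simp add: s'_def)
    qed simp
  qed
  then show ?thesis by simp
qed

lemma dwork_add:
  assumes "dwork f" "dwork g"
  shows "dwork (\<lambda>n. f n + g n)"
  unfolding dwork_def
proof (intro allI impI)
  fix p j n :: nat
  assume *: "prime p" "n > 0" "j > 0" "p ^ j dvd n"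
  have eq: "of_int (1 - m) * (f n + g n - ph p (f (n div p) + g (n div p)))
      = of_int (1 - m) * (f n - ph p (f (n div p))) + of_int (1 - m) * (g n - ph p (g (n div p)))"
    using ph_hom[OF *(1)] by (simp add: unital_hom_def algebra_simps)
  show "if int p dvd 1 - m then of_int (int (p ^ j)) dvd f n + g n
      else of_int (int (p ^ j)) dvd of_int (1 - m) * (f n + g n - ph p (f (n div p) + g (n div p)))"
    using dworkD[OF assms(1) *] dworkD[OF assms(2) *] unfolding eq
    by (cases "int p dvd 1 - m") (simp_all only: if_True if_False not_False_eq_True dvd_add)
qed

lemma dwork_mult:
  assumes "dwork f" "dwork g"
  shows "dwork (\<lambda>n. of_int (1 - m) * f n * g n)"
  unfolding dwork_def
proof (intro allI impI)
  fix p j n :: nat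
  assume *: "prime p" "n > 0" "j > 0" "p ^ j dvd n"
  let ?c = "of_int (1 - m) :: 'a" and ?f = "ph p (f (n div p))" and ?g = "ph p (g (n div p))"
  have ph: "ph p (?c * f (n div p) * g (n div p)) = ?c * ?f * ?g"
    using ph_hom[OF *(1)] unital_hom_of_int[OF ph_hom[OF *(1)], of "1 - m"] by (simp only: unital_hom_def)
  \<comment> \<open>The product rule, with one of the two factors 1 - m placed on each difference,
    the form in which the congruences are known.\<close>
  have eq: "?c * (?c * f n * g n - ?c * ?f * ?g)
      = (?c * (f n - ?f)) * (?c * g n) + (?c * ?f) * (?c * (g n - ?g))"
    by (simp add: algebra_simps)
  show "if int p dvd 1 - m then of_int (int (p ^ j)) dvd ?c * f n * g n
      else of_int (int (p ^ j)) dvd ?c * (?c * f n * g n - ph p (?c * f (n div p) * g (n div p)))"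
    using dworkD[OF assms(1) *] dworkD[OF assms(2) *] unfolding ph eq
    by (cases "int p dvd 1 - m") (simp_all only: if_True if_False not_False_eq_True dvd_add dvd_mult dvd_mult2)
qed

end

text \<open>By \<open>peval_eq_transfer\<close> the value does not depend on the expression chosen
  by \<open>zexpr\<close>, so an identity checked at rational points can be evaluated in any
  commutative ring.\<close>

definition zeval :: "('v \<Rightarrow> 'a::comm_ring_1) \<Rightarrow> 'v zpoly \<Rightarrow> 'a" where
  "zeval w f = peval w (zexpr f)"

lemma zeval_zof [simp]: "zeval w (zof p) = peval w p"
  unfolding zeval_def by (rule peval_eq_transfer) simp

lemma zeval_zvar [simp]: "zeval w (zvar v) = w v"
  by (simp add: zvar_def)

lemma unital_hom_zeval: "unital_hom (zeval w)"
proof -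
  have "zeval w 1 = zeval w (zof (PConst 1))" by (intro arg_cong[of _ _ "zeval w"] zpoly_eqI) simp
  moreover have "zeval w (f + g) = zeval w (zof (PAdd (zexpr f) (zexpr g)))" for f g
    by (intro arg_cong[of _ _ "zeval w"] zpoly_eqI) simp
  moreover have "zeval w (f * g) = zeval w (zof (PMul (zexpr f) (zexpr g)))" for f g
    by (intro arg_cong[of _ _ "zeval w"] zpoly_eqI) simp
  ultimately show ?thesis unfolding unital_hom_def zeval_zof by (simp add: zeval_def)
qed

lemma zeval_simps [simp]:
  "zeval w (f + g) = zeval w f + zeval w g" "zeval w (f * g) = zeval w f * zeval w g"
  "zeval w (f - g) = zeval w f - zeval w g" "zeval w (1 :: 'v zpoly) = 1"
  "zeval w (of_int c :: 'v zpoly) = of_int c" "zeval w (of_nat n :: 'v zpoly) = of_nat n"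
  "zeval w (f ^ n) = zeval w f ^ n" "zeval w (sum h A) = (\<Sum>i\<in>A. zeval w (h i))"
  "zeval w (peval s p) = peval (\<lambda>u. zeval w (s u)) p"
proof -
  note hom = unital_hom_zeval[of w]
  show "zeval w (f + g) = zeval w f + zeval w g" "zeval w (f * g) = zeval w f * zeval w g"
    "zeval w (1 :: 'v zpoly) = 1"
    using hom by (simp_all add: unital_hom_def)
  show "zeval w (f - g) = zeval w f - zeval w g" by (rule unital_hom_diff[OF hom])
  show "zeval w (of_int c :: 'v zpoly) = of_int c" by (rule unital_hom_of_int[OF hom])
  show "zeval w (of_nat n :: 'v zpoly) = of_nat n" by (rule unital_hom_of_nat[OF hom])
  show "zeval w (f ^ n) = zeval w f ^ n" by (rule unital_hom_power[OF hom])
  show "zeval w (sum h A) = (\<Sum>i\<in>A. zeval w (h i))" by (rule unital_hom_sum[OF hom])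
  show "zeval w (peval s p) = peval (\<lambda>u. zeval w (s u)) p" by (rule unital_hom_peval[OF hom])
qed

section \<open>Integrality of the universal polynomials\<close>

text \<open>Substituting v^p for each variable agrees with the p-th power modulo p, by
  \<open>frobenius_dvd\<close>.\<close>

lemma ghost_setting_power:
  "ghost_setting (\<lambda>k x. x ^ k) (\<lambda>p. zcomp (\<lambda>v. zvar v ^ p) :: 'v zpoly \<Rightarrow> 'v zpoly)"
proof
  fix p k j :: nat and x :: "'v zpoly"
  assume *: "prime p" "k > 0" "p ^ j dvd k" "j > 0"
  let ?F = "zcomp (\<lambda>v. zvar v ^ p) :: 'v zpoly \<Rightarrow> 'v zpoly"
  have "of_int (int p) dvd peval (\<lambda>v. zvar v ^ p) (zexpr x) - peval zvar (zexpr x) ^ p"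
    by (rule frobenius_dvd[OF *(1)])
  then have "of_int (int p) dvd ?F x - x ^ p"
    by (simp add: zcomp_def zof_eq_peval[symmetric])
  then have "of_int (int p) dvd x ^ p - ?F x" by (rule dvd_diff_swap)
  from power_frobenius_dvd[OF * this]
  show "of_int (int (p ^ j)) dvd x ^ k - ?F (x ^ (k div p))"
    by (simp only: unital_hom_power[OF unital_hom_zcomp])
qed (simp_all add: unital_hom_zcomp)

lemma ghost_setting_endo:
  assumes "\<And>x. T (Suc 0) x = x" "\<And>k. k > 0 \<Longrightarrow> unital_hom (T k)"
    and "\<And>k l x. k > 0 \<Longrightarrow> l > 0 \<Longrightarrow> T k (T l x) = T (k * l) x"
  shows "ghost_setting T T"
proof
  fix p k j :: nat and x
  assume *: "prime p" "k > 0" "p ^ j dvd k" "j > 0"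
  have "p dvd k" using * by (metis dvd_power dvd_trans)
  then obtain l where l: "k = p * l" ..
  then have "T p (T (k div p) x) = T k x"
    using * assms(3)[of p l x] by (simp add: prime_gt_0_nat)
  then show "of_int (int (p ^ j)) dvd T k x - T p (T (k div p) x)" by simp
qed (use assms prime_gt_0_nat in auto)

lemma ex_WS:
  "\<exists>S. \<forall>n\<ge>1. \<forall>(x::nat \<Rightarrow> rat) (y::nat \<Rightarrow> rat).
      (\<Sum>d\<in>{d. d dvd n}. of_nat d * of_int (qbr m (n div d)) * peval (case_sum x y) (S d) ^ (n div d))
    = (\<Sum>d\<in>{d. d dvd n}. of_nat d * of_int (qbr m (n div d)) * (x d ^ (n div d) + y d ^ (n div d)))"
proof -
  interpret ghost_setting m "\<lambda>k x. x ^ k" "\<lambda>p. zcomp (\<lambda>v. zvar v ^ p) :: (nat + nat) zpoly \<Rightarrow> _"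
    by (rule ghost_setting_power)
  have "dwork (\<lambda>n. ghost (\<lambda>d. zvar (Inl d)) n + ghost (\<lambda>d. zvar (Inr d)) n)"
    by (intro dwork_add dwork_ghost)
  from dwork_imp_ghost[OF this] obtain s
    where s: "\<And>n. n > 0 \<Longrightarrow> ghost (\<lambda>d. zvar (Inl d)) n + ghost (\<lambda>d. zvar (Inr d)) n = ghost s n"
    by blast
  show ?thesis
  proof (intro exI[of _ "\<lambda>d. zexpr (s d)"] allI impI)
    fix n :: nat and x y :: "nat \<Rightarrow> rat" assume "n \<ge> 1"
    then have "zev (ghost (\<lambda>d. zvar (Inl d)) n + ghost (\<lambda>d. zvar (Inr d)) n) (case_sum x y)
        = zev (ghost s n) (case_sum x y)"
      by (simp only: s)
    then show "(\<Sum>d\<in>{d. d dvd n}. of_nat d * of_int (qbr m (n div d))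
          * peval (case_sum x y) (zexpr (s d)) ^ (n div d))
      = (\<Sum>d\<in>{d. d dvd n}. of_nat d * of_int (qbr m (n div d)) * (x d ^ (n div d) + y d ^ (n div d)))"
      by (simp add: ghost_def distrib_left sum.distrib)
  qed
qed

lemma ex_WP:
  "\<exists>P. \<forall>n\<ge>1. \<forall>(x::nat \<Rightarrow> rat) (y::nat \<Rightarrow> rat).
      (\<Sum>d\<in>{d. d dvd n}. of_nat d * of_int (qbr m (n div d)) * peval (case_sum x y) (P d) ^ (n div d))
    = (1 - of_int m) * (\<Sum>d\<in>{d. d dvd n}. of_nat d * of_int (qbr m (n div d)) * x d ^ (n div d))
                     * (\<Sum>d\<in>{d. d dvd n}. of_nat d * of_int (qbr m (n div d)) * y d ^ (n div d))"
proof -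
  interpret ghost_setting m "\<lambda>k x. x ^ k" "\<lambda>p. zcomp (\<lambda>v. zvar v ^ p) :: (nat + nat) zpoly \<Rightarrow> _"
    by (rule ghost_setting_power)
  have "dwork (\<lambda>n. of_int (1 - m) * ghost (\<lambda>d. zvar (Inl d)) n * ghost (\<lambda>d. zvar (Inr d)) n)"
    by (intro dwork_mult dwork_ghost)
  from dwork_imp_ghost[OF this] obtain s where s: "\<And>n. n > 0 \<Longrightarrow>
      of_int (1 - m) * ghost (\<lambda>d. zvar (Inl d)) n * ghost (\<lambda>d. zvar (Inr d)) n = ghost s n"
    by blast
  show ?thesis
  proof (intro exI[of _ "\<lambda>d. zexpr (s d)"] allI impI)
    fix n :: nat and x y :: "nat \<Rightarrow> rat" assume "n \<ge> 1"
    then have "zev (ghost s n) (case_sum x y)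
        = zev (of_int (1 - m) * ghost (\<lambda>d. zvar (Inl d)) n * ghost (\<lambda>d. zvar (Inr d)) n) (case_sum x y)"
      by (simp only: s)
    then show "(\<Sum>d\<in>{d. d dvd n}. of_nat d * of_int (qbr m (n div d))
          * peval (case_sum x y) (zexpr (s d)) ^ (n div d))
      = (1 - of_int m) * (\<Sum>d\<in>{d. d dvd n}. of_nat d * of_int (qbr m (n div d)) * x d ^ (n div d))
                       * (\<Sum>d\<in>{d. d dvd n}. of_nat d * of_int (qbr m (n div d)) * y d ^ (n div d))"
      by (simp add: ghost_def)
  qed
qed

lemma ex_BP:
  "\<exists>P. \<forall>n\<ge>1. \<forall>(v::bool \<times> nat \<times> nat \<Rightarrow> rat).
      (\<Sum>d\<in>{d. d dvd n}. of_nat d * of_int (qbr m (n div d)) *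
          peval (\<lambda>(c,e,k). v (c, e, (n div d) * k)) (P d))
    = (1 - of_int m) * (\<Sum>d\<in>{d. d dvd n}. of_nat d * of_int (qbr m (n div d)) * v (True, d, n div d))
                     * (\<Sum>d\<in>{d. d dvd n}. of_nat d * of_int (qbr m (n div d)) * v (False, d, n div d))"
proof -
  \<comment> \<open>Psi^k on the free Psi-ring; its generators x_d and y_d are the variables with
    last index 1.\<close>
  define T where "T k = (zcomp (\<lambda>(c,e,l). zvar (c, e, k * l)) :: (bool \<times> nat \<times> nat) zpoly \<Rightarrow> _)" for k
  have zev_T: "zev (T k f) v = zev f (\<lambda>(c,e,l). v (c, e, k * l))" for k f v
    by (simp add: T_def case_prod_unfold)
  interpret ghost_setting m T T
  proof (rule ghost_setting_endo)
    show "T (Suc 0) x = x" for x by (rule zpoly_eqI) (simp add: zev_T)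
    show "unital_hom (T k)" for k unfolding T_def by (rule unital_hom_zcomp)
    show "T k (T l x) = T (k * l) x" for k l x
      by (rule zpoly_eqI) (simp add: zev_T case_prod_unfold mult.assoc)
  qed
  let ?x = "\<lambda>c d. zvar (c, d, Suc 0)"
  have "dwork (\<lambda>n. of_int (1 - m) * ghost (?x True) n * ghost (?x False) n)"
    by (intro dwork_mult dwork_ghost)
  from dwork_imp_ghost[OF this] obtain s
    where s: "\<And>n. n > 0 \<Longrightarrow> of_int (1 - m) * ghost (?x True) n * ghost (?x False) n = ghost s n"
    by blast
  show ?thesis
  proof (intro exI[of _ "\<lambda>d. zexpr (s d)"] allI impI)
    fix n :: nat and v :: "bool \<times> nat \<times> nat \<Rightarrow> rat" assume "n \<ge> 1"
    then have "zev (ghost s n) v = zev (of_int (1 - m) * ghost (?x True) n * ghost (?x False) n) v"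
      by (simp only: s)
    then show "(\<Sum>d\<in>{d. d dvd n}. of_nat d * of_int (qbr m (n div d)) *
          peval (\<lambda>(c,e,k). v (c, e, (n div d) * k)) (zexpr (s d)))
    = (1 - of_int m) * (\<Sum>d\<in>{d. d dvd n}. of_nat d * of_int (qbr m (n div d)) * v (True, d, n div d))
                     * (\<Sum>d\<in>{d. d dvd n}. of_nat d * of_int (qbr m (n div d)) * v (False, d, n div d))"
      by (simp add: ghost_def zev_T)
  qed
qed

text \<open>In a lambda-ring psi^p lifts Frobenius. On roots this is the congruence between the p-th
  power of a sum and the sum of p-th powers; \<open>esym_division1\<close> turns it into
  divisibility of a polynomial in the e_i.\<close>

lemma npow_prime_dvd:
  fixes w :: "nat \<Rightarrow> 'a::comm_ring_1"
  assumes "prime p" "w 0 = 1"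
  shows "of_int (int p) dvd w 1 ^ p - npow w p"
proof -
  have p: "p > 0" using assms(1) by (rule prime_gt_0_nat)
  define g :: "nat zpoly" where "g = zvar 1 ^ p - npow zvar p"
  have "\<exists>h. \<forall>\<xi>. peval (esyms N \<xi>) (zexpr g) = of_int (int p) * zev h \<xi>" for N
  proof -
    define q :: "nat ipoly" where "q = psum (map PVar [0..<N])"
    have q: "peval u q = (\<Sum>j<N. u j)" for u :: "nat \<Rightarrow> nat zpoly"
      by (simp add: q_def comp_def sum_list_distinct_conv_sum_set atLeast0LessThan)
    have "of_int (int p) dvd peval (\<lambda>v. zvar v ^ p) q - peval zvar q ^ p"
      by (rule frobenius_dvd[OF assms(1)])
    from dvd_diff_swap[OF this]
    have "of_int (int p) dvd (\<Sum>j<N. zvar j) ^ p - (\<Sum>j<N. zvar j ^ p :: nat zpoly)"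
      by (simp add: q)
    then obtain h where "(\<Sum>j<N. zvar j) ^ p - (\<Sum>j<N. zvar j ^ p :: nat zpoly) = of_int (int p) * h" ..
    then have "zev ((\<Sum>j<N. zvar j) ^ p - (\<Sum>j<N. zvar j ^ p :: nat zpoly)) \<xi> = zev (of_int (int p) * h) \<xi>" for \<xi>
      by simp
    then have "peval (esyms N \<xi>) (zexpr g) = of_int (int p) * zev h \<xi>" for \<xi>
      using p by (simp add: g_def npow_esym esym_1)
    then show ?thesis by blast
  qed
  from esym_division1[OF this] obtain G where G: "\<And>w :: nat \<Rightarrow> rat. w 0 = 1 \<Longrightarrow>
      peval w (zexpr g) = of_int (int p) * peval w G"
    by blast
  let ?s = "\<lambda>i. if i = 0 then PConst 1 else PVar i"
  have s: "(\<lambda>i. peval w (?s i)) = w" using assms(2) by auto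
  have "peval w (psubst ?s (zexpr g)) = peval w (PMul (PConst (int p)) (psubst ?s G))"
    by (rule peval_eq_transfer) (simp add: G del: peval_zexpr)
  then have "zeval w g = of_int (int p) * peval w G"
    by (simp add: s zeval_def)
  moreover have "zeval w g = w 1 ^ p - npow w p"
    using unital_hom_npow[OF unital_hom_zeval, of w zvar p] by (simp add: g_def)
  ultimately show ?thesis by simp
qed

lemma ex_Mpoly:
  "\<exists>Q. \<forall>n\<ge>1. \<forall>(N::nat) (\<xi>::nat \<Rightarrow> rat).
      (\<Sum>d\<in>{d. d dvd n}. of_nat d * of_int (qbr m (n div d)) *
          peval (\<lambda>i. esym i {..<N} (\<lambda>j. \<xi> j ^ (n div d))) (Q d))
      = of_int (qbr m n) * (\<Sum>j<N. \<xi> j) ^ n"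
proof -
  \<comment> \<open>The free lambda-ring on one generator: variable j stands for lambda^(j+1), and
    \<open>case_nat\<close> puts in lambda^0 = 1. \<open>T k\<close> is psi^k, given on the
    generators by \<open>psilam\<close>.\<close>
  define T where "T k = (zcomp (\<lambda>j. peval (case_nat 1 zvar) (psilam k (Suc j))) :: nat zpoly \<Rightarrow> _)" for k
  have ext: "(\<lambda>i. zev (case_nat 1 zvar i) w) = case_nat 1 w" for w
    by (auto simp: fun_eq_iff split: nat.split)
  have zev_T: "zev (T k f) w = zev f (\<lambda>j. peval (case_nat 1 w) (psilam k (Suc j)))" for k f w
    by (simp add: T_def ext)
  have ext_psilam: "case_nat 1 (\<lambda>j. peval (case_nat 1 w) (psilam k (Suc j)))
      = (\<lambda>i. peval (case_nat 1 w) (psilam k i))" if "k > 0" for k and w :: "nat \<Rightarrow> rat"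
    using that by (auto simp: fun_eq_iff psilam_0 split: nat.split)
  interpret ghost_setting m T T
  proof (rule ghost_setting_endo)
    have "peval (case_nat 1 w) (psilam (Suc 0) i) = case_nat 1 w i" for w :: "nat \<Rightarrow> rat" and i
      using verification1[of "psilam (Suc 0) i" "PVar i" "case_nat 1 w"] by (simp add: peval_psilam_esyms)
    then show "T (Suc 0) x = x" for x by (intro zpoly_eqI) (simp add: zev_T)
    show "unital_hom (T k)" for k unfolding T_def by (rule unital_hom_zcomp)
    show "T k (T l x) = T (k * l) x" if "k > 0" "l > 0" for k l x
      using that by (intro zpoly_eqI) (simp add: zev_T ext_psilam psilam_psilam)
  qed
  \<comment> \<open>The right-hand side of the recursion is a Witt ghost component with a single
    entry at d = 1, but the congruence is needed for psi^p in place of p-th powers;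
    \<open>npow_prime_dvd\<close> bridges the gap.\<close>
  have "dwork (\<lambda>n. of_int (qbr m n) * zvar 0 ^ n)"
    unfolding dwork_def
  proof (intro allI impI)
    fix p j n :: nat
    assume *: "prime p" "n > 0" "j > 0" "p ^ j dvd n"
    let ?c = "of_int (1 - m) :: nat zpoly" and ?x = "zvar 0 :: nat zpoly"
    let ?y = "T p ?x"
    show "if int p dvd 1 - m then of_int (int (p ^ j)) dvd of_int (qbr m n) * ?x ^ n
      else of_int (int (p ^ j)) dvd ?c * (of_int (qbr m n) * ?x ^ n
        - T p (of_int (qbr m (n div p)) * ?x ^ (n div p)))"
    proof (cases "int p dvd 1 - m")
      case True
      obtain b where "n = p ^ j * b" using *(4) ..
      then show ?thesis
        using True of_int_dvd_of_int_mult[OF prime_power_dvd_qbr[OF True, of j b]] by simp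
    next
      case False
      have c: "?c * of_int (qbr m k) = of_int (1 - m ^ k)" for k
        by (simp only: of_int_mult[symmetric] one_minus_mult_qbr)
      have Tp: "T p (of_int (qbr m (n div p)) * ?x ^ (n div p)) = of_int (qbr m (n div p)) * ?y ^ (n div p)"
        using ph_hom[OF *(1)] unital_hom_power[OF ph_hom[OF *(1)]] unital_hom_of_int[OF ph_hom[OF *(1)]]
        by (simp only: unital_hom_def)
      have eq: "?c * (of_int (qbr m n) * ?x ^ n - T p (of_int (qbr m (n div p)) * ?x ^ (n div p)))
          = of_int (1 - m ^ n) * (?x ^ n - ?y ^ (n div p)) + of_int (m ^ (n div p) - m ^ n) * ?y ^ (n div p)"
        unfolding Tp right_diff_distrib mult.assoc[symmetric] c by (simp add: algebra_simps)
      have "?y = npow (case_nat 1 zvar) p"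
        using *(1) by (intro zpoly_eqI) (simp add: zev_T ext psilam_1[simplified] prime_gt_0_nat)
      then have "of_int (int p) dvd ?x ^ p - ?y"
        using npow_prime_dvd[OF *(1), of "case_nat 1 zvar :: nat \<Rightarrow> nat zpoly"] by simp
      then have dvd1: "of_int (int (p ^ j)) dvd ?x ^ n - ?y ^ (n div p)"
        using * by (intro power_frobenius_dvd)
      have "int p dvd m ^ p - m" using fermat_dvd[OF *(1), of m] by (rule dvd_diff_swap)
      then have "int (p ^ j) dvd m ^ n - m ^ (n div p)"
        using power_frobenius_dvd[of p n j m m] * by simp
      then have dvd2: "int (p ^ j) dvd m ^ (n div p) - m ^ n" by (rule dvd_diff_swap)
      show ?thesis
        unfolding eq using False
        by (simp only: if_False) (intro dvd_add dvd_mult dvd1 of_int_dvd_of_int_mult[OF dvd2])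
    qed
  qed
  from dwork_imp_ghost[OF this] obtain s
    where s: "\<And>n. n > 0 \<Longrightarrow> of_int (qbr m n) * zvar 0 ^ n = ghost s n"
    by blast
  \<comment> \<open>Back to indices starting at lambda^0, as in the definition of
    \<open>Mpoly\<close>.\<close>
  define Q where "Q d = psubst (\<lambda>j. PVar (Suc j)) (zexpr (s d))" for d
  show ?thesis
  proof (intro exI[of _ Q] allI impI)
    fix n N :: nat and \<xi> :: "nat \<Rightarrow> rat" assume n: "n \<ge> 1"
    let ?w = "\<lambda>j. esyms N \<xi> (Suc j)"
    have w: "case_nat 1 ?w = esyms N \<xi>" by (auto simp: fun_eq_iff split: nat.split)
    have T: "zev (T (n div d) (s d)) ?w = peval (esyms N (\<lambda>j. \<xi> j ^ (n div d))) (Q d)" if "d dvd n" for d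
    proof -
      have "n div d > 0" using that n by (auto elim: dvdE)
      then show ?thesis by (simp add: zev_T w peval_psilam_esyms Q_def)
    qed
    have "zev (ghost s n) ?w = zev (of_int (qbr m n) * zvar 0 ^ n) ?w"
      using s n by simp
    then show "(\<Sum>d\<in>{d. d dvd n}. of_nat d * of_int (qbr m (n div d)) *
          peval (\<lambda>i. esym i {..<N} (\<lambda>j. \<xi> j ^ (n div d))) (Q d))
      = of_int (qbr m n) * (\<Sum>j<N. \<xi> j) ^ n"
      by (simp add: ghost_def T esym_1)
  qed
qed

section \<open>The defining identities in arbitrary commutative rings\<close>

lemma WS_ghost:
  fixes x y :: "nat \<Rightarrow> 'a::comm_ring_1"
  assumes "n > 0"
  shows "(\<Sum>d | d dvd n. of_nat d * of_int (qbr m (n div d)) * peval (case_sum x y) (WS m d) ^ (n div d))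
    = (\<Sum>d | d dvd n. of_nat d * of_int (qbr m (n div d)) * (x d ^ (n div d) + y d ^ (n div d)))"
proof -
  have eq: "(\<Sum>d | d dvd n. of_nat d * of_int (qbr m (n div d)) * zof (WS m d) ^ (n div d))
    = (\<Sum>d | d dvd n. of_nat d * of_int (qbr m (n div d))
        * (zvar (Inl d) ^ (n div d) + zvar (Inr d) ^ (n div d)))"
  proof (rule zpoly_eqI)
    fix w :: "nat + nat \<Rightarrow> rat"
    have "case_sum (w \<circ> Inl) (w \<circ> Inr) = w" by (auto simp: fun_eq_iff split: sum.split)
    then show "zev (\<Sum>d | d dvd n. of_nat d * of_int (qbr m (n div d)) * zof (WS m d) ^ (n div d)) w
      = zev (\<Sum>d | d dvd n. of_nat d * of_int (qbr m (n div d))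
        * (zvar (Inl d) ^ (n div d) + zvar (Inr d) ^ (n div d))) w"
      using someI_ex[OF ex_WS[of m], folded WS_def, rule_format, of n "w \<circ> Inl" "w \<circ> Inr"] assms
      by simp
  qed
  show ?thesis using arg_cong[OF eq, of "zeval (case_sum x y)"] by simp
qed

lemma WP_ghost:
  fixes x y :: "nat \<Rightarrow> 'a::comm_ring_1"
  assumes "n > 0"
  shows "(\<Sum>d | d dvd n. of_nat d * of_int (qbr m (n div d)) * peval (case_sum x y) (WP m d) ^ (n div d))
    = (1 - of_int m) * (\<Sum>d | d dvd n. of_nat d * of_int (qbr m (n div d)) * x d ^ (n div d))
        * (\<Sum>d | d dvd n. of_nat d * of_int (qbr m (n div d)) * y d ^ (n div d))"
proof -
  have eq: "(\<Sum>d | d dvd n. of_nat d * of_int (qbr m (n div d)) * zof (WP m d) ^ (n div d))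
    = (1 - of_int m) * (\<Sum>d | d dvd n. of_nat d * of_int (qbr m (n div d)) * zvar (Inl d) ^ (n div d))
        * (\<Sum>d | d dvd n. of_nat d * of_int (qbr m (n div d)) * zvar (Inr d) ^ (n div d))"
    (is "?L = ?R")
  proof (rule zpoly_eqI)
    fix w :: "nat + nat \<Rightarrow> rat"
    have "case_sum (w \<circ> Inl) (w \<circ> Inr) = w" by (auto simp: fun_eq_iff split: sum.split)
    then show "zev ?L w = zev ?R w"
      using someI_ex[OF ex_WP[of m], folded WP_def, rule_format, of n "w \<circ> Inl" "w \<circ> Inr"] assms
      by simp
  qed
  show ?thesis using arg_cong[OF eq, of "zeval (case_sum x y)"] by simp
qed

lemma BP_ghost:
  fixes v :: "bool \<times> nat \<times> nat \<Rightarrow> 'a::comm_ring_1"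
  assumes "n > 0"
  shows "(\<Sum>d | d dvd n. of_nat d * of_int (qbr m (n div d)) *
          peval (\<lambda>(c,e,k). v (c, e, (n div d) * k)) (BP m d))
    = (1 - of_int m) * (\<Sum>d | d dvd n. of_nat d * of_int (qbr m (n div d)) * v (True, d, n div d))
                     * (\<Sum>d | d dvd n. of_nat d * of_int (qbr m (n div d)) * v (False, d, n div d))"
proof -
  have eq: "(\<Sum>d | d dvd n. of_nat d * of_int (qbr m (n div d)) *
          peval (\<lambda>(c,e,k). zvar (c, e, (n div d) * k)) (BP m d))
    = (1 - of_int m) * (\<Sum>d | d dvd n. of_nat d * of_int (qbr m (n div d)) * zvar (True, d, n div d))
                     * (\<Sum>d | d dvd n. of_nat d * of_int (qbr m (n div d)) * zvar (False, d, n div d))"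
    (is "?L = ?R")
  proof (rule zpoly_eqI)
    fix w
    show "zev ?L w = zev ?R w"
      using someI_ex[OF ex_BP[of m], folded BP_def, rule_format, of n w] assms
      by (simp add: case_prod_unfold)
  qed
  show ?thesis using arg_cong[OF eq, of "zeval v"] by (simp add: case_prod_unfold)
qed

text \<open>The defining recursion has psi^(n/d) act on roots. \<open>psilam\<close> rewrites this
  action through lambda-operations, after which the splitting principle applies.\<close>

lemma Mpoly_ghost:
  fixes w :: "nat \<Rightarrow> 'a::comm_ring_1"
  assumes "n > 0" "w 0 = 1"
  shows "(\<Sum>d | d dvd n. of_nat d * of_int (qbr m (n div d)) *
          peval (\<lambda>i. peval w (psilam (n div d) i)) (Mpoly m d)) = of_int (qbr m n) * w 1 ^ n"
proof -
  define L :: "nat zpoly" where "L = (\<Sum>d | d dvd n. of_nat d * of_int (qbr m (n div d)) *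
          peval (\<lambda>i. zof (psilam (n div d) i)) (Mpoly m d))"
  define R :: "nat zpoly" where "R = of_int (qbr m n) * zvar 1 ^ n"
  have "peval w (zexpr L) = peval w (zexpr R)"
  proof (rule verification1)
    fix N :: nat and \<xi> :: "nat \<Rightarrow> rat"
    have eq: "of_nat d * of_int (qbr m (n div d)) * peval (\<lambda>i. peval (esyms N \<xi>) (psilam (n div d) i)) (Mpoly m d)
        = of_nat d * of_int (qbr m (n div d)) * peval (esyms N (\<lambda>j. \<xi> j ^ (n div d))) (Mpoly m d)"
      if "d dvd n" for d
    proof -
      have "n div d > 0" using that assms(1) by (auto elim: dvdE)
      then show ?thesis by (simp add: peval_psilam_esyms)
    qed
    show "peval (esyms N \<xi>) (zexpr L) = peval (esyms N \<xi>) (zexpr R)"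
      using someI_ex[OF ex_Mpoly[of m], folded Mpoly_def, rule_format, of n N \<xi>] assms(1)
      by (simp add: L_def R_def eq esym_1)
  qed (fact assms)
  then have "zeval w L = zeval w R" by (simp add: zeval_def)
  then show ?thesis by (simp add: L_def R_def)
qed

lemma Mpoly_1: "w 0 = 1 \<Longrightarrow> peval w (Mpoly m (Suc 0)) = w 1"
proof -
  assume w: "w 0 = 1"
  have "peval w (psilam (Suc 0) i) = w i" for i
    using verification1[of "psilam (Suc 0) i" "PVar i" w] w by (simp add: peval_psilam_esyms)
  then show ?thesis using Mpoly_ghost[of "Suc 0" w m] w by simp
qed

section \<open>Adams operations and ghost components\<close>

lemma lambda_ringD:
  assumes "lambda_ring lam"
  shows "lam 0 x = 1" "lam (Suc 0) x = x" "lam n (x + y) = (\<Sum>i\<le>n. lam i x * lam (n - i) y)"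
    "n \<ge> 2 \<Longrightarrow> lam n 1 = 0"
    "lam n (x * y) = peval (case_sum (\<lambda>i. lam i x) (\<lambda>j. lam j y)) (lamP n)"
    "lam n (lam k x) = peval (\<lambda>i. lam i x) (lamPP n k)"
  using assms unfolding lambda_ring_def One_nat_def by blast+

lemma adams_1 [simp]: "lambda_ring lam \<Longrightarrow> adams lam (Suc 0) x = x"
  by (simp add: adams.simps lambda_ringD)

lemma adams_0 [simp]: "adams lam 0 x = 0"
  by (simp add: adams.simps)

lemma unital_hom_adams:
  assumes "lambda_ring lam" "k > 0"
  shows "unital_hom (adams lam k)"
  unfolding unital_hom_def
proof (intro conjI allI)
  note lam = lambda_ringD[OF assms(1)]
  have "npow (\<lambda>i. lam i 1) k = lam 1 1 ^ k" by (rule npow_line) (use assms lam in auto)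
  then show "adams lam k 1 = 1" by (simp add: adams_eq_npow lam)
  show "adams lam k (x + y) = adams lam k x + adams lam k y" for x y
    using npow_convolution[of "\<lambda>i. lam i x" "\<lambda>i. lam i y" k] by (simp add: adams_eq_npow lam)
  show "adams lam k (x * y) = adams lam k x * adams lam k y" for x y
    by (simp add: adams_eq_npow lam npow_lamP)
qed

lemma adams_lam:
  assumes "lambda_ring lam"
  shows "adams lam k (lam i x) = peval (\<lambda>j. lam j x) (psilam k i)"
  by (simp add: adams_eq_npow lambda_ringD[OF assms] peval_psilam)

text \<open>psi^k is a ring homomorphism, so it may be applied inside Newton's polynomial for psi^l,
  where \<open>psilam\<close> describes its effect on lambda^i.\<close>

lemma adams_adams:
  assumes "lambda_ring lam" "k > 0"
  shows "adams lam k (adams lam l x) = adams lam (k * l) x"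
proof -
  have "adams lam k (adams lam l x) = npow (\<lambda>i. adams lam k (lam i x)) l"
    unfolding adams_eq_npow[of lam l] by (rule unital_hom_npow[OF unital_hom_adams[OF assms]])
  also have "\<dots> = npow (\<lambda>i. lam i x) (k * l)"
    using assms by (simp add: adams_lam npow_psilam lambda_ringD)
  finally show ?thesis by (simp add: adams_eq_npow)
qed

text \<open>The normalisation by [n/d]_m instead of 1 - m^(n/d); \<open>Phi_eq\<close> and
  \<open>phi_eq\<close> relate it to the maps of the theorem.\<close>

definition bghost :: "int \<Rightarrow> (nat \<Rightarrow> 'a::comm_ring_1 \<Rightarrow> 'a) \<Rightarrow> (nat \<Rightarrow> 'a) \<Rightarrow> nat \<Rightarrow> 'a" where
  "bghost m lam u n = (\<Sum>d | d dvd n. of_nat d * of_int (qbr m (n div d)) * adams lam (n div d) (u d))"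

definition wghost :: "int \<Rightarrow> (nat \<Rightarrow> 'a::comm_ring_1) \<Rightarrow> nat \<Rightarrow> 'a" where
  "wghost m a n = (\<Sum>d | d dvd n. of_nat d * of_int (qbr m (n div d)) * a d ^ (n div d))"

lemma div_pos_if_dvd: "d dvd n \<Longrightarrow> n > 0 \<Longrightarrow> n div d > (0::nat)"
  by (auto elim: dvdE)

lemma bghost_Mm:
  assumes "lambda_ring lam" "n > 0"
  shows "bghost m lam (Mm m lam r) n = of_int (qbr m n) * r ^ n"
proof -
  have "adams lam (n div d) (Mm m lam r d) = peval (\<lambda>i. peval (\<lambda>j. lam j r) (psilam (n div d) i)) (Mpoly m d)"
    if "d dvd n" for d
    by (simp add: Mm_def unital_hom_peval[OF unital_hom_adams[OF assms(1) div_pos_if_dvd[OF that assms(2)]]]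
        adams_lam[OF assms(1)])
  then show ?thesis
    using Mpoly_ghost[OF assms(2), of "\<lambda>j. lam j r" m] by (simp add: bghost_def lambda_ringD[OF assms(1)])
qed

lemma Mm_1: "lambda_ring lam \<Longrightarrow> Mm m lam r (Suc 0) = r"
  by (simp add: Mm_def Mpoly_1 lambda_ringD)

text \<open>The chains e | d | n are regrouped by \<open>e\<close>, with d = e c.\<close>

lemma sum_dvd_dvd:
  fixes n :: nat
  assumes "n > 0"
  shows "(\<Sum>d | d dvd n. \<Sum>e | e dvd d. F d e) = (\<Sum>e | e dvd n. \<Sum>c | c dvd n div e. F (e * c) e)"
proof -
  have fin: "finite {e. e dvd d}" if "d \<in> {d. d dvd n}" for d
    using that assms by (auto intro!: finite_divisors_nat elim: dvdE)
  have fin': "finite {c. c dvd n div e}" if "e \<in> {e. e dvd n}" for e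
    using that assms by (auto intro!: finite_divisors_nat elim: dvdE)
  have fin0: "finite {d. d dvd n}" using assms by simp
  have "(\<Sum>d | d dvd n. \<Sum>e | e dvd d. F d e)
      = (\<Sum>(d, e)\<in>(SIGMA d:{d. d dvd n}. {e. e dvd d}). F d e)"
    using fin fin0 by (subst sum.Sigma) auto
  also have "\<dots> = (\<Sum>(e, c)\<in>(SIGMA e:{e. e dvd n}. {c. c dvd n div e}). F (e * c) e)"
    by (rule sum.reindex_bij_witness[where j = "\<lambda>(d, e). (e, d div e)" and i = "\<lambda>(e, c). (e * c, e)"])
      (use assms in \<open>auto elim!: dvdE\<close>)
  also have "\<dots> = (\<Sum>e | e dvd n. \<Sum>c | c dvd n div e. F (e * c) e)"
    using fin' fin0 by (subst sum.Sigma) auto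
  finally show ?thesis .
qed

text \<open>Regrouped by \<open>e\<close>, the double sum contains the recursion for M(a_e, -) at
  n/e. It contributes e [n/e]_m a_e^(n/e), the Witt summand.\<close>

lemma bghost_tau:
  assumes "lambda_ring lam" "n > 0"
  shows "bghost m lam (tau m lam a) n = wghost m a n"
proof -
  have "bghost m lam (tau m lam a) n = (\<Sum>d | d dvd n. \<Sum>e | e dvd d.
      of_nat d * of_int (qbr m (n div d)) * adams lam (n div d) (Mm m lam (a e) (d div e)))"
    unfolding bghost_def
  proof (rule sum.cong[OF refl])
    fix d assume d: "d \<in> {d. d dvd n}"
    then have "d > 0" using assms(2) by (auto elim: dvdE)
    moreover have "n div d > 0" using d assms(2) by (simp add: div_pos_if_dvd)
    ultimately show "of_nat d * of_int (qbr m (n div d)) * adams lam (n div d) (tau m lam a d)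
        = (\<Sum>e | e dvd d. of_nat d * of_int (qbr m (n div d)) * adams lam (n div d) (Mm m lam (a e) (d div e)))"
      by (simp add: tau_def sum_distrib_left unital_hom_sum[OF unital_hom_adams[OF assms(1)]])
  qed
  also have "\<dots> = (\<Sum>e | e dvd n. \<Sum>c | c dvd n div e. of_nat (e * c) * of_int (qbr m (n div (e * c)))
      * adams lam (n div (e * c)) (Mm m lam (a e) (e * c div e)))"
    by (rule sum_dvd_dvd[OF assms(2)])
  also have "\<dots> = (\<Sum>e | e dvd n. of_nat e * bghost m lam (Mm m lam (a e)) (n div e))"
    unfolding bghost_def sum_distrib_left
    using assms(2) by (intro sum.cong) (auto simp: div_mult2_eq mult.assoc elim!: dvdE)
  also have "\<dots> = wghost m a n"
    unfolding wghost_def using assms by (intro sum.cong) (auto simp: bghost_Mm div_pos_if_dvd mult.assoc)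
  finally show ?thesis .
qed

lemma one_minus_mult_of_int_qbr:
  fixes x :: "'a::comm_ring_1"
  shows "(1 - of_int m) * (of_nat d * of_int (qbr m k) * x) = of_nat d * (1 - of_int m ^ k) * x"
proof -
  have "(1 - of_int m) * of_int (qbr m k) = (1 - of_int m ^ k :: 'a)"
    using arg_cong[OF one_minus_mult_qbr[of m k], of "of_int :: int \<Rightarrow> 'a"] by simp
  then have "of_nat d * ((1 - of_int m) * of_int (qbr m k)) * x = of_nat d * (1 - of_int m ^ k) * x"
    by simp
  then show ?thesis by (simp only: mult_ac)
qed

lemma Phi_eq: "n > 0 \<Longrightarrow> Phi m a n = (1 - of_int m) * wghost m a n"
  by (simp add: Phi_def wghost_def sum_distrib_left one_minus_mult_of_int_qbr)

lemma phi_eq: "n > 0 \<Longrightarrow> phi m lam a n = (1 - of_int m) * bghost m lam a n"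
  by (simp add: phi_def bghost_def sum_distrib_left one_minus_mult_of_int_qbr)

lemma Phi_eq_phi_tau:
  assumes "lambda_ring lam" shows "Phi m = phi m lam \<circ> tau m lam"
proof (intro ext)
  fix a n
  show "Phi m a n = (phi m lam \<circ> tau m lam) a n"
  proof (cases "n = 0")
    case False
    then show ?thesis using assms by (simp add: Phi_eq phi_eq bghost_tau)
  qed (simp add: Phi_def phi_def)
qed

text \<open>The n-th ghost component is n u_n plus terms in u_d for proper divisors d, and n can be
  cancelled.\<close>

lemma bghost_inject:
  fixes u v :: "nat \<Rightarrow> 'a::comm_ring_1"
  assumes "lambda_ring lam" and tf: "\<And>n x :: 'a. n > 0 \<Longrightarrow> of_nat n * x = 0 \<Longrightarrow> x = 0"
    and eq: "\<And>n. n > 0 \<Longrightarrow> bghost m lam u n = bghost m lam v n" and "n > 0"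
  shows "u n = v n"
  using \<open>n > 0\<close>
proof (induction n rule: less_induct)
  case (less n)
  have split: "{d. d dvd n} = insert n {d. d dvd n \<and> d \<noteq> n}" by auto
  have fin: "finite {d. d dvd n \<and> d \<noteq> n}" using less.prems by simp
  have "bghost m lam u n = of_nat n * u n
      + (\<Sum>d | d dvd n \<and> d \<noteq> n. of_nat d * of_int (qbr m (n div d)) * adams lam (n div d) (u d))" for u
    unfolding bghost_def by (subst split, subst sum.insert) (use fin less.prems assms(1) in auto)
  moreover have "(\<Sum>d | d dvd n \<and> d \<noteq> n. of_nat d * of_int (qbr m (n div d)) * adams lam (n div d) (u d))
      = (\<Sum>d | d dvd n \<and> d \<noteq> n. of_nat d * of_int (qbr m (n div d)) * adams lam (n div d) (v d))"
  proof (rule sum.cong[OF refl])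
    fix d assume d: "d \<in> {d. d dvd n \<and> d \<noteq> n}"
    then have "d < n" "d > 0"
      using less.prems dvd_imp_le[of d n] dvd_pos_nat[of n d] by auto
    then show "of_nat d * of_int (qbr m (n div d)) * adams lam (n div d) (u d)
        = of_nat d * of_int (qbr m (n div d)) * adams lam (n div d) (v d)"
      using less.IH by simp
  qed
  ultimately have "of_nat n * (u n - v n) = 0"
    using eq[OF less.prems] by (simp add: right_diff_distrib)
  then show ?case using tf[OF less.prems, of "u n - v n"] by simp
qed

lemma bghost_B_add:
  assumes "lambda_ring lam" "n > 0"
  shows "bghost m lam (B_add u v) n = bghost m lam u n + bghost m lam v n"
  unfolding bghost_def sum.distrib[symmetric]
proof (rule sum.cong[OF refl])
  fix d assume "d \<in> {d. d dvd n}"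
  then have "unital_hom (adams lam (n div d))"
    using assms by (intro unital_hom_adams) (auto simp: div_pos_if_dvd)
  then show "of_nat d * of_int (qbr m (n div d)) * adams lam (n div d) (B_add u v d)
      = of_nat d * of_int (qbr m (n div d)) * adams lam (n div d) (u d)
      + of_nat d * of_int (qbr m (n div d)) * adams lam (n div d) (v d)"
    by (simp add: B_add_def unital_hom_def distrib_left)
qed

text \<open>psi^(n/d) is a ring homomorphism and composes with psi^k to psi^((n/d) k), so evaluating
  \<open>BP\<close> at Adams operations respects the Psi-structure.\<close>

lemma bghost_B_mult:
  assumes "lambda_ring lam" "n > 0"
  shows "bghost m lam (B_mult m lam u v) n = (1 - of_int m) * bghost m lam u n * bghost m lam v n"
proof -
  define V where "V = (\<lambda>(c, e, k). adams lam k (if c then u e else v e))"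
  have "bghost m lam (B_mult m lam u v) n = (\<Sum>d | d dvd n. of_nat d * of_int (qbr m (n div d)) *
      peval (\<lambda>(c, e, k). V (c, e, (n div d) * k)) (BP m d))"
    unfolding bghost_def
  proof (rule sum.cong[OF refl])
    fix d assume d: "d \<in> {d. d dvd n}"
    then have pos: "n div d > 0" "d > 0" using assms(2) by (auto simp: div_pos_if_dvd elim: dvdE)
    have "adams lam (n div d) (B_mult m lam u v d) = adams lam (n div d) (peval V (BP m d))"
      using pos by (simp add: B_mult_def V_def)
    also have "\<dots> = peval (\<lambda>x. adams lam (n div d) (V x)) (BP m d)"
      using unital_hom_peval[OF unital_hom_adams[OF assms(1) pos(1)]] .
    also have "(\<lambda>x. adams lam (n div d) (V x)) = (\<lambda>(c, e, k). V (c, e, (n div d) * k))"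
      using assms(1) pos by (auto simp: V_def adams_adams)
    finally show "of_nat d * of_int (qbr m (n div d)) * adams lam (n div d) (B_mult m lam u v d)
        = of_nat d * of_int (qbr m (n div d)) * peval (\<lambda>(c, e, k). V (c, e, (n div d) * k)) (BP m d)"
      by simp
  qed
  also have "\<dots> = (1 - of_int m) * bghost m lam u n * bghost m lam v n"
    unfolding BP_ghost[OF assms(2)] by (simp add: bghost_def V_def)
  finally show ?thesis .
qed

lemma wghost_W_add: "n > 0 \<Longrightarrow> wghost m (W_add m a b) n = wghost m a n + wghost m b n"
proof -
  assume n: "n > 0"
  have "wghost m (W_add m a b) n
      = (\<Sum>d | d dvd n. of_nat d * of_int (qbr m (n div d)) * peval (case_sum a b) (WS m d) ^ (n div d))"
    unfolding wghost_def using n by (intro sum.cong) (auto simp: W_add_def)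
  then show ?thesis unfolding WS_ghost[OF n] by (simp add: wghost_def distrib_left sum.distrib)
qed

lemma wghost_W_mult:
  "n > 0 \<Longrightarrow> wghost m (W_mult m a b) n = (1 - of_int m) * wghost m a n * wghost m b n"
proof -
  assume n: "n > 0"
  have "wghost m (W_mult m a b) n
      = (\<Sum>d | d dvd n. of_nat d * of_int (qbr m (n div d)) * peval (case_sum a b) (WP m d) ^ (n div d))"
    unfolding wghost_def using n by (intro sum.cong) (auto simp: W_mult_def)
  then show ?thesis unfolding WP_ghost[OF n] by (simp add: wghost_def)
qed

lemma tau_W_add_torsion_free:
  fixes lam :: "nat \<Rightarrow> 'a::comm_ring_1 \<Rightarrow> 'a"
  assumes "lambda_ring lam" "\<And>n x :: 'a. n > 0 \<Longrightarrow> of_nat n * x = 0 \<Longrightarrow> x = 0"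
  shows "tau m lam (W_add m a b) = B_add (tau m lam a) (tau m lam b)"
proof
  fix n
  show "tau m lam (W_add m a b) n = B_add (tau m lam a) (tau m lam b) n"
  proof (cases "n = 0")
    case False
    show ?thesis
    proof (rule bghost_inject[where m = m and lam = lam])
      show "bghost m lam (tau m lam (W_add m a b)) n = bghost m lam (B_add (tau m lam a) (tau m lam b)) n"
        if "n > 0" for n
        using that assms(1) by (simp add: bghost_tau bghost_B_add wghost_W_add)
    qed (use False in \<open>simp_all only: assms\<close>)
  qed (simp add: tau_def B_add_def)
qed

lemma tau_W_mult_torsion_free:
  fixes lam :: "nat \<Rightarrow> 'a::comm_ring_1 \<Rightarrow> 'a"
  assumes "lambda_ring lam" "\<And>n x :: 'a. n > 0 \<Longrightarrow> of_nat n * x = 0 \<Longrightarrow> x = 0"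
  shows "tau m lam (W_mult m a b) = B_mult m lam (tau m lam a) (tau m lam b)"
proof
  fix n
  show "tau m lam (W_mult m a b) n = B_mult m lam (tau m lam a) (tau m lam b) n"
  proof (cases "n = 0")
    case False
    show ?thesis
    proof (rule bghost_inject[where m = m and lam = lam])
      show "bghost m lam (tau m lam (W_mult m a b)) n = bghost m lam (B_mult m lam (tau m lam a) (tau m lam b)) n"
        if "n > 0" for n
        using that assms(1) by (simp add: bghost_tau bghost_B_mult wghost_W_mult)
    qed (use False in \<open>simp_all only: assms\<close>)
  qed (simp add: tau_def B_mult_def)
qed

section \<open>A torsion-free model\<close>

text \<open>The inverse of \<open>npow\<close>: elementary symmetric functions from prescribed power
  sums. The division by n is why the model takes rational values.\<close>

fun inv_newton :: "(nat \<Rightarrow> rat) \<Rightarrow> nat \<Rightarrow> rat" where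
  "inv_newton p n = (if n = 0 then 1 else
     (\<Sum>i<n. inv_newton p i * ((-1) ^ (n - i + 1) * p (n - i))) / of_nat n)"

declare inv_newton.simps [simp del]

lemma inv_newton_0 [simp]: "inv_newton p 0 = 1"
  by (simp add: inv_newton.simps)

lemma npow_inv_newton: "n > 0 \<Longrightarrow> npow (inv_newton p) n = p n"
  by (rule npow_unique) (simp, subst inv_newton.simps, simp)

lemma inv_newton_eqI:
  assumes "w 0 = 1" "\<And>k. k > 0 \<Longrightarrow> npow w k = p k"
  shows "inv_newton p n = w n"
  by (rule npow_inject) (use assms in \<open>simp_all add: npow_inv_newton\<close>)

text \<open>Points are power-sum coordinates: \<open>u v k\<close> is the value of \<open>\<psi>\<^sup>k(x\<^sub>v)\<close>.  On functions of them
  \<open>\<psi>\<^sup>k\<close> acts by precomposition, and the lambda-operations are recovered from Newton's identities.\<close>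
definition frob :: "nat \<Rightarrow> ('v \<Rightarrow> nat \<Rightarrow> rat) \<Rightarrow> 'v \<Rightarrow> nat \<Rightarrow> rat" where
  "frob k u = (\<lambda>v l. u v (k * l))"

definition model_lam :: "nat \<Rightarrow> (('v \<Rightarrow> nat \<Rightarrow> rat) \<Rightarrow> rat) \<Rightarrow> ('v \<Rightarrow> nat \<Rightarrow> rat) \<Rightarrow> rat" where
  "model_lam n F = (\<lambda>u. inv_newton (\<lambda>k. F (frob k u)) n)"

lemma frob_frob: "frob l (frob k u) = frob (k * l) u"
  by (simp add: frob_def mult.assoc)

lemma unital_hom_apply: "unital_hom (\<lambda>F :: 'x \<Rightarrow> 'a::comm_ring_1. F u)"
  by (simp add: unital_hom_def)

lemma inv_newton_psilam:
  assumes "k > 0"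
  shows "inv_newton (\<lambda>l. p (k * l)) j = peval (inv_newton p) (psilam k j)"
  by (rule inv_newton_eqI) (use assms in \<open>simp_all add: psilam_0 npow_psilam npow_inv_newton\<close>)

text \<open>Each axiom is checked pointwise on power sums, where it reduces to the additivity,
  multiplicativity or composition rule for Adams operations.\<close>

lemma lambda_ring_model: "lambda_ring (model_lam :: nat \<Rightarrow> (('v \<Rightarrow> nat \<Rightarrow> rat) \<Rightarrow> rat) \<Rightarrow> _)"
  unfolding lambda_ring_def
proof (intro conjI allI impI)
  fix x y :: "('v \<Rightarrow> nat \<Rightarrow> rat) \<Rightarrow> rat" and n k :: nat
  show "model_lam 0 x = 1" by (simp add: model_lam_def fun_eq_iff)
  show "model_lam 1 x = x"
    by (simp add: model_lam_def fun_eq_iff inv_newton.simps[of _ "Suc 0"]) (simp add: frob_def)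
  show "model_lam n (x + y) = (\<Sum>i\<le>n. model_lam i x * model_lam (n - i) y)"
  proof
    fix u
    have "inv_newton (\<lambda>k. x (frob k u) + y (frob k u)) n
        = (\<Sum>i\<le>n. inv_newton (\<lambda>k. x (frob k u)) i * inv_newton (\<lambda>k. y (frob k u)) (n - i))"
      by (rule inv_newton_eqI) (simp_all add: npow_convolution npow_inv_newton)
    then show "model_lam n (x + y) u = (\<Sum>i\<le>n. model_lam i x * model_lam (n - i) y) u"
      using unital_hom_sum[OF unital_hom_apply[of u], of "\<lambda>i. model_lam i x * model_lam (n - i) y" "{..n}"]
      by (simp add: model_lam_def)
  qed
  show "model_lam n (x * y) = peval (\<lambda>v. case v of Inl i \<Rightarrow> model_lam i x | Inr j \<Rightarrow> model_lam j y) (lamP n)"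
    (is "_ = peval ?V _")
  proof
    fix u
    have "inv_newton (\<lambda>k. x (frob k u) * y (frob k u)) n
        = peval (case_sum (inv_newton (\<lambda>k. x (frob k u))) (inv_newton (\<lambda>k. y (frob k u)))) (lamP n)"
      by (rule inv_newton_eqI) (simp_all add: npow_lamP npow_inv_newton lamP_0)
    also have "case_sum (inv_newton (\<lambda>k. x (frob k u))) (inv_newton (\<lambda>k. y (frob k u)))
        = (\<lambda>v. ?V v u)"
      by (auto simp: fun_eq_iff model_lam_def split: sum.split)
    also have "peval (\<lambda>v. ?V v u) (lamP n) = peval ?V (lamP n) u"
      by (rule unital_hom_peval[OF unital_hom_apply[of u], symmetric])
    finally show "model_lam n (x * y) u = peval ?V (lamP n) u"
      by (simp only: model_lam_def times_fun_apply)
  qed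
  show "model_lam n (model_lam k x) = peval (\<lambda>i. model_lam i x) (lamPP n k)"
  proof
    fix u
    let ?p = "\<lambda>l. x (frob l u)"
    have "inv_newton (\<lambda>l. inv_newton (\<lambda>i. ?p (l * i)) k) n = peval (inv_newton ?p) (lamPP n k)"
      by (rule inv_newton_eqI) (simp_all add: lamPP_0 inv_newton_psilam[where p = ?p] peval_psilam)
    then show "model_lam n (model_lam k x) u = peval (\<lambda>i. model_lam i x) (lamPP n k) u"
      using unital_hom_peval[OF unital_hom_apply[of u], of "\<lambda>i. model_lam i x" "lamPP n k"]
      by (simp add: model_lam_def frob_frob)
  qed
next
  fix n :: nat assume "n \<ge> 2"
  \<comment> \<open>Power sums constantly 1 belong to a single root 1, with generating series 1 +
    X.\<close>
  have "inv_newton (\<lambda>k. 1) n = (if n \<le> 1 then 1 else 0)"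
    by (rule inv_newton_eqI) (simp_all add: npow_line)
  then show "model_lam n (1 :: ('v \<Rightarrow> nat \<Rightarrow> rat) \<Rightarrow> rat) = 0"
    using \<open>n \<ge> 2\<close> by (simp add: model_lam_def fun_eq_iff)
qed

lemma model_torsion_free:
  assumes "n > 0" "of_nat n * F = (0 :: 'x \<Rightarrow> rat)"
  shows "F = 0"
proof
  fix u
  have "(of_nat n * F) u = 0" using assms(2) by simp
  then have "of_nat n * F u = 0"
    using unital_hom_of_nat[OF unital_hom_apply[of u], of n] by simp
  then show "F u = 0 u" using assms(1) by simp
qed

section \<open>Transfer from the model\<close>

locale lambda_pair =
  fixes lam1 :: "nat \<Rightarrow> 'a::comm_ring_1 \<Rightarrow> 'a" and lam2 :: "nat \<Rightarrow> 'b::comm_ring_1 \<Rightarrow> 'b"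
    and g1 :: "'v \<Rightarrow> 'a" and g2 :: "'v \<Rightarrow> 'b"
  assumes lam1: "lambda_ring lam1" and lam2: "lambda_ring lam2"
begin

abbreviation "ev1 \<equiv> peval (\<lambda>(v, i). lam1 i (g1 v))"
abbreviation "ev2 \<equiv> peval (\<lambda>(v, i). lam2 i (g2 v))"

text \<open>The image, in the product of both rings, of the lambda-ring freely generated by the
  indices \<open>v\<close>. This relation replaces the free lambda-ring and its
  homomorphisms.\<close>

definition rel :: "'a \<Rightarrow> 'b \<Rightarrow> bool" where
  "rel r s \<longleftrightarrow> (\<exists>p. r = ev1 p \<and> s = ev2 p)"

lemma rel_ev: "rel (ev1 p) (ev2 p)"
  unfolding rel_def by blast

lemma rel_of_int: "rel (of_int c) (of_int c)"
  using rel_ev[of "PConst c"] by simp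

lemma rel_0: "rel 0 0"
  using rel_of_int[of 0] by simp

lemma rel_add: "rel r s \<Longrightarrow> rel r' s' \<Longrightarrow> rel (r + r') (s + s')"
proof -
  assume "rel r s" "rel r' s'"
  then obtain p q where "r = ev1 p" "s = ev2 p" "r' = ev1 q" "s' = ev2 q" by (auto simp: rel_def)
  then show ?thesis using rel_ev[of "PAdd p q"] by simp
qed

lemma rel_mult: "rel r s \<Longrightarrow> rel r' s' \<Longrightarrow> rel (r * r') (s * s')"
proof -
  assume "rel r s" "rel r' s'"
  then obtain p q where "r = ev1 p" "s = ev2 p" "r' = ev1 q" "s' = ev2 q" by (auto simp: rel_def)
  then show ?thesis using rel_ev[of "PMul p q"] by simp
qed

lemma rel_minus: "rel r s \<Longrightarrow> rel (- r) (- s)"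
  using rel_mult[OF rel_of_int[of "-1"]] by simp

lemma rel_sum: "(\<And>i. i \<in> A \<Longrightarrow> rel (f i) (h i)) \<Longrightarrow> rel (sum f A) (sum h A)"
  by (induction A rule: infinite_finite_induct) (auto simp: rel_0 rel_add)

lemma rel_peval:
  assumes "\<And>v. rel (f v) (h v)" shows "rel (peval f p) (peval h p)"
  by (induction p) (simp_all add: assms rel_of_int rel_add rel_mult)

lemma rel_gen: "rel (g1 v) (g2 v)"
  using rel_ev[of "PVar (v, Suc 0)"] by (simp add: lambda_ringD[OF lam1] lambda_ringD[OF lam2])

text \<open>Needed for negative constants, since no axiom speaks of -r: expand lambda^n(r + (-r)) =
  lambda^n(0) and solve for lambda^n(-r).\<close>

lemma rel_lam_minus:
  assumes "\<And>n. rel (lam1 n r) (lam2 n s)"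
  shows "rel (lam1 n (- r)) (lam2 n (- s))"
proof (induction n rule: less_induct)
  case (less n)
  have rec: "lam n (- x) = lam n 0 - (\<Sum>i\<in>{1..n}. lam i x * lam (n - i) (- x))" if "lambda_ring lam"
    for lam :: "nat \<Rightarrow> 'c::comm_ring_1 \<Rightarrow> 'c" and x
  proof -
    have "{..n} = insert 0 {1..n}" by auto
    then have "lam n (x + - x) = lam n (- x) + (\<Sum>i\<in>{1..n}. lam i x * lam (n - i) (- x))"
      by (simp only: lambda_ringD(3)[OF that]) (simp add: lambda_ringD(1)[OF that])
    then show ?thesis by simp
  qed
  \<comment> \<open>For n > 0, lambda^n(0 + 0) is twice lambda^n(0) plus products of lower values,
    which vanish by induction.\<close>
  have zero: "lam n 0 = (if n = 0 then 1 else 0)" if "lambda_ring lam"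
    for lam :: "nat \<Rightarrow> 'c::comm_ring_1 \<Rightarrow> 'c" and n
  proof (induction n rule: less_induct)
    case (less n)
    show ?case
    proof (cases "n = 0")
      case False
      then have eq: "{..n} = insert 0 (insert n {1..<n})" by auto
      have "lam n (0 + 0) = lam n 0 + lam n 0 + (\<Sum>i\<in>{1..<n}. lam i 0 * lam (n - i) 0)"
        using False by (simp only: lambda_ringD(3)[OF that] eq) (simp add: lambda_ringD(1)[OF that])
      also have "(\<Sum>i\<in>{1..<n}. lam i 0 * lam (n - i) 0) = 0"
        using less by (intro sum.neutral) auto
      finally show ?thesis using False by simp
    qed (simp add: lambda_ringD(1)[OF that])
  qed
  have "rel (lam1 n 0) (lam2 n 0)"
    using rel_of_int[of 0] rel_of_int[of 1] by (simp add: zero[OF lam1] zero[OF lam2])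
  moreover have "rel (\<Sum>i\<in>{1..n}. lam1 i r * lam1 (n - i) (- r)) (\<Sum>i\<in>{1..n}. lam2 i s * lam2 (n - i) (- s))"
    using less by (intro rel_sum rel_mult assms) auto
  ultimately show ?case
    unfolding rec[OF lam1] rec[OF lam2] diff_conv_add_uminus by (intro rel_add rel_minus)
qed

text \<open>Nested operations are rewritten by \<open>lamPP\<close>, products by \<open>lamP\<close>
  and sums by the addition rule; constants are reached from 1 by adding and subtracting 1.\<close>

lemma rel_lam_ev: "rel (lam1 n (ev1 p)) (lam2 n (ev2 p))"
proof (induction p arbitrary: n)
  case (PVar x)
  obtain v k where "x = (v, k)" by (cases x)
  then show ?case
    using rel_ev[of "psubst (\<lambda>i. PVar (v, i)) (lamPP n k)"]
    by (simp add: lambda_ringD(6)[OF lam1] lambda_ringD(6)[OF lam2])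
next
  case (PConst c)
  have one: "rel (lam1 n 1) (lam2 n 1)" for n
  proof (cases "n \<ge> 2")
    case False
    then have "n = 0 \<or> n = Suc 0" by auto
    then show ?thesis
      using rel_of_int[of 1] by (auto simp: lambda_ringD[OF lam1] lambda_ringD[OF lam2])
  qed (simp add: lambda_ringD[OF lam1] lambda_ringD[OF lam2] rel_0)
  have add: "rel (lam1 n (r + r')) (lam2 n (s + s'))"
    if "\<And>n. rel (lam1 n r) (lam2 n s)" "\<And>n. rel (lam1 n r') (lam2 n s')" for r r' s s' n
    unfolding lambda_ringD(3)[OF lam1] lambda_ringD(3)[OF lam2] by (intro rel_sum rel_mult that)
  have "rel (lam1 n (of_int c)) (lam2 n (of_int c))" for n
  proof (induction c arbitrary: n rule: int_induct[where k = 1])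
    case base
    then show ?case using one by simp
  next
    case (step1 i)
    then show ?case using add[OF step1(2) one] by simp
  next
    case (step2 i)
    then show ?case using add[OF step2(2) rel_lam_minus[OF one]] by simp
  qed
  then show ?case by simp
next
  case (PAdd p q)
  then show ?case
    by (simp add: lambda_ringD(3)[OF lam1] lambda_ringD(3)[OF lam2]) (intro rel_sum rel_mult; simp)
next
  case (PMul p q)
  have "rel (peval (case_sum (\<lambda>i. lam1 i (ev1 p)) (\<lambda>i. lam1 i (ev1 q))) (lamP n))
    (peval (case_sum (\<lambda>i. lam2 i (ev2 p)) (\<lambda>i. lam2 i (ev2 q))) (lamP n))"
    using PMul by (intro rel_peval) (auto split: sum.split)
  then show ?case by (simp add: lambda_ringD(5)[OF lam1] lambda_ringD(5)[OF lam2])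
qed

lemma rel_lam: "rel r s \<Longrightarrow> rel (lam1 n r) (lam2 n s)"
  using rel_lam_ev unfolding rel_def[of r s] by auto

lemma rel_adams: "rel r s \<Longrightarrow> rel (adams lam1 n r) (adams lam2 n s)"
  using rel_peval[of "\<lambda>i. lam1 i r" "\<lambda>i. lam2 i s" "newtonp n"] rel_lam by (simp add: adams_eq_npow)

lemma rel_tau:
  assumes "\<And>d. rel (a d) (b d)"
  shows "rel (tau m lam1 a n) (tau m lam2 b n)"
  using assms by (auto simp: tau_def Mm_def intro!: rel_sum rel_peval rel_lam rel_0)

lemma rel_case_sum:
  "(\<And>d. rel (a d) (b d)) \<Longrightarrow> (\<And>d. rel (a' d) (b' d)) \<Longrightarrow> rel (case_sum a a' v) (case_sum b b' v)"
  by (cases v) auto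

lemma rel_W_add:
  assumes "\<And>d. rel (a d) (b d)" "\<And>d. rel (a' d) (b' d)"
  shows "rel (W_add m a a' n) (W_add m b b' n)"
  using assms by (auto simp: W_add_def intro!: rel_peval rel_case_sum rel_0)

lemma rel_W_mult:
  assumes "\<And>d. rel (a d) (b d)" "\<And>d. rel (a' d) (b' d)"
  shows "rel (W_mult m a a' n) (W_mult m b b' n)"
  using assms by (auto simp: W_mult_def intro!: rel_peval rel_case_sum rel_0)

lemma rel_B_mult:
  assumes "\<And>d. rel (a d) (b d)" "\<And>d. rel (a' d) (b' d)"
  shows "rel (B_mult m lam1 a a' n) (B_mult m lam2 b b' n)"
  using assms by (auto simp: B_mult_def intro!: rel_peval rel_adams rel_0)

end

definition model_var :: "'v \<Rightarrow> ('v \<Rightarrow> nat \<Rightarrow> rat) \<Rightarrow> rat" where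
  "model_var v = (\<lambda>u. u v 1)"

text \<open>The model is free enough: power-sum coordinates are unconstrained and hence reach every
  rational assignment of lambda-values with lambda^0 = 1, so expressions that agree in the model
  agree in every lambda-ring.\<close>

lemma model_rel_unique:
  fixes lam :: "nat \<Rightarrow> 'a::comm_ring_1 \<Rightarrow> 'a" and g :: "'v \<Rightarrow> 'a"
  assumes "lambda_ring lam"
    and "lambda_pair.rel lam model_lam g model_var r F" "lambda_pair.rel lam model_lam g model_var r' F"
  shows "r = r'"
proof -
  interpret lambda_pair lam model_lam g model_var
    using assms(1) lambda_ring_model by unfold_locales
  obtain p q where p: "r = ev1 p" "F = ev2 p" and q: "r' = ev1 q" "F = ev2 q"
    using assms(2,3) unfolding rel_def by blast
  have val: "ev2 p u = peval (\<lambda>(v, i). inv_newton (u v) i) p" for p u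
    using unital_hom_peval[OF unital_hom_apply[of u], of "\<lambda>(v, i). model_lam i (model_var v)" p]
    by (simp add: case_prod_unfold model_lam_def model_var_def frob_def)
  have agree: "peval w p = peval w q" if "\<And>v. w (v, 0) = 1" for w :: "'v \<times> nat \<Rightarrow> rat"
  proof -
    \<comment> \<open>A sequence starting with 1 is recovered from its power sums, so
      \<open>w\<close> comes from a point of the model.\<close>
    have "inv_newton (npow (\<lambda>i. w (v, i))) i = w (v, i)" for v i
      by (rule inv_newton_eqI) (simp_all add: that)
    then have "peval w s = ev2 s (\<lambda>v. npow (\<lambda>i. w (v, i)))" for s
      unfolding val by (intro peval_cong) (simp add: case_prod_unfold)
    then show ?thesis using p q by metis
  qed
  \<comment> \<open>Forces the value 1 at index 0, which makes the rational identity unconditional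
    before transfer.\<close>
  let ?s = "\<lambda>x. if snd x = 0 then PConst 1 else PVar x"
  have "ev1 (psubst ?s p) = ev1 (psubst ?s q)"
    by (rule peval_eq_transfer) (simp add: agree)
  moreover have "(\<lambda>x. peval (\<lambda>(v, i). lam i (g v)) (?s x)) = (\<lambda>(v, i). lam i (g v))"
    by (auto simp: fun_eq_iff lambda_ringD[OF assms(1)])
  ultimately show ?thesis unfolding p(1) q(1) by (simp only: peval_psubst)
qed

section \<open>The homomorphism property in a general lambda-ring, then bijectivity and
  naturality\<close>

lemma tau_W_add:
  assumes "lambda_ring lam"
  shows "tau m lam (W_add m a b) = B_add (tau m lam a) (tau m lam b)"
proof
  fix n
  interpret lambda_pair lam model_lam "case_sum a b" "model_var :: nat + nat \<Rightarrow> _"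
    using assms lambda_ring_model by unfold_locales
  \<comment> \<open>The generic pair of sequences, with one free generator for each entry.\<close>
  let ?A = "\<lambda>d. model_var (Inl d :: nat + nat)" and ?B = "\<lambda>d. model_var (Inr d :: nat + nat)"
  have a: "rel (a d) (?A d)" and b: "rel (b d) (?B d)" for d
    using rel_gen[of "Inl d"] rel_gen[of "Inr d"] by simp_all
  have "rel (tau m lam (W_add m a b) n) (tau m model_lam (W_add m ?A ?B) n)"
    by (intro rel_tau rel_W_add a b)
  moreover have "rel (B_add (tau m lam a) (tau m lam b) n) (B_add (tau m model_lam ?A) (tau m model_lam ?B) n)"
    unfolding B_add_def by (intro rel_add rel_tau a b)
  moreover have "tau m model_lam (W_add m ?A ?B) = B_add (tau m model_lam ?A) (tau m model_lam ?B)"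
    by (rule tau_W_add_torsion_free[OF lambda_ring_model]) (rule model_torsion_free)
  ultimately show "tau m lam (W_add m a b) n = B_add (tau m lam a) (tau m lam b) n"
    by (intro model_rel_unique[OF assms]) simp_all
qed

lemma tau_W_mult:
  assumes "lambda_ring lam"
  shows "tau m lam (W_mult m a b) = B_mult m lam (tau m lam a) (tau m lam b)"
proof
  fix n
  interpret lambda_pair lam model_lam "case_sum a b" "model_var :: nat + nat \<Rightarrow> _"
    using assms lambda_ring_model by unfold_locales
  let ?A = "\<lambda>d. model_var (Inl d :: nat + nat)" and ?B = "\<lambda>d. model_var (Inr d :: nat + nat)"
  have a: "rel (a d) (?A d)" and b: "rel (b d) (?B d)" for d
    using rel_gen[of "Inl d"] rel_gen[of "Inr d"] by simp_all
  have "rel (tau m lam (W_mult m a b) n) (tau m model_lam (W_mult m ?A ?B) n)"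
    by (intro rel_tau rel_W_mult a b)
  moreover have "rel (B_mult m lam (tau m lam a) (tau m lam b) n)
      (B_mult m model_lam (tau m model_lam ?A) (tau m model_lam ?B) n)"
    by (intro rel_B_mult rel_tau a b)
  moreover have "tau m model_lam (W_mult m ?A ?B) = B_mult m model_lam (tau m model_lam ?A) (tau m model_lam ?B)"
    by (rule tau_W_mult_torsion_free[OF lambda_ring_model]) (rule model_torsion_free)
  ultimately show "tau m lam (W_mult m a b) n = B_mult m lam (tau m lam a) (tau m lam b) n"
    by (intro model_rel_unique[OF assms]) simp_all
qed

text \<open>M(r, 1) = r makes \<open>tau\<close> unitriangular with respect to divisibility.\<close>

lemma tau_split:
  assumes "lambda_ring lam" "n > 0"
  shows "tau m lam a n = a n + (\<Sum>d | d dvd n \<and> d \<noteq> n. Mm m lam (a d) (n div d))"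
proof -
  have split: "{d. d dvd n} = insert n {d. d dvd n \<and> d \<noteq> n}" by auto
  have fin: "finite {d. d dvd n \<and> d \<noteq> n}" using assms(2) by simp
  have "tau m lam a n = (\<Sum>d | d dvd n. Mm m lam (a d) (n div d))" using assms(2) by (simp add: tau_def)
  then show ?thesis
    by (subst (asm) split, subst (asm) sum.insert) (use fin assms in \<open>auto simp: Mm_1\<close>)
qed

lemma bij_betw_tau:
  assumes "lambda_ring lam" shows "bij_betw (tau m lam) seqs seqs"
  unfolding bij_betw_def
proof
  show "inj_on (tau m lam) seqs"
  proof (intro inj_onI ext)
    fix a b n assume ab: "a \<in> seqs" "b \<in> seqs" "tau m lam a = tau m lam b"
    show "a n = b n"
    proof (induction n rule: less_induct)
      case (less n)
      show ?case
      proof (cases "n = 0")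
        case False
        have "a d = b d" if "d dvd n \<and> d \<noteq> n" for d
          using that False less by (metis dvd_imp_le gr0I le_neq_implies_less)
        then have "(\<Sum>d | d dvd n \<and> d \<noteq> n. Mm m lam (a d) (n div d))
            = (\<Sum>d | d dvd n \<and> d \<noteq> n. Mm m lam (b d) (n div d))"
          by (intro sum.cong) auto
        then show ?thesis
          using tau_split[OF assms, of n m a] tau_split[OF assms, of n m b] False ab(3) by simp
      qed (use ab in \<open>simp add: seqs_def\<close>)
    qed
  qed
  show "tau m lam ` seqs = seqs"
  proof (intro equalityI subsetI)
    fix b :: "nat \<Rightarrow> 'a" assume b: "b \<in> seqs"
    \<comment> \<open>The entry that solves the equation at n; only entries at smaller indices
      enter, so the recursion is well founded. The value 0 at index 0 keeps the solution in
      \<open>seqs\<close>.\<close>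
    let ?P = "\<lambda>a n r. r = (if n = 0 then 0 else
      b n - (\<Sum>d | d dvd n \<and> d \<noteq> n. Mm m lam (a d) (n div d)))"
    have "\<exists>a. \<forall>n. ?P a n (a n)"
    proof (rule dependent_wellorder_choice)
      fix r :: 'a and f g :: "nat \<Rightarrow> 'a" and n :: nat
      assume eq: "\<And>y. y < n \<Longrightarrow> f y = g y"
      have "f d = g d" if "d dvd n \<and> d \<noteq> n" "n \<noteq> 0" for d
        using that eq by (metis dvd_imp_le gr0I le_neq_implies_less)
      then show "?P f n r = ?P g n r" by simp
    qed blast
    then obtain a where a: "\<And>n. ?P a n (a n)" by blast
    have "tau m lam a n = b n" for n
    proof (cases "n = 0")
      case False
      then show ?thesis using tau_split[OF assms, of n m a] a[of n] by simp
    qed (use b in \<open>simp add: tau_def seqs_def\<close>)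
    moreover have "a \<in> seqs" using a[of 0] by (simp add: seqs_def)
    ultimately show "b \<in> tau m lam ` seqs" by (metis ext image_eqI)
  qed (auto simp: seqs_def tau_def)
qed

text \<open>Universal expressions commute with lambda-homomorphisms.\<close>

lemma tau_natural:
  assumes "lambda_hom lamR lamS f"
  shows "tau m lamS (f \<circ> a) = f \<circ> tau m lamR a"
proof
  fix n
  have f: "unital_hom f" "f (lamR i x) = lamS i (f x)" for i x
    using assms by (auto simp: lambda_hom_def unital_hom_def)
  have "f (Mm m lamR x k) = Mm m lamS (f x) k" for x k
    by (simp add: Mm_def unital_hom_peval[OF f(1)] f(2))
  then show "tau m lamS (f \<circ> a) n = (f \<circ> tau m lamR a) n"
    by (simp add: tau_def unital_hom_0[OF f(1)] unital_hom_sum[OF f(1)])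
qed

theorem theorem7p11:
  fixes m :: int
    and lamR :: "nat \<Rightarrow> 'a::comm_ring_1 \<Rightarrow> 'a"
    and lamS :: "nat \<Rightarrow> 'b::comm_ring_1 \<Rightarrow> 'b"
  assumes "lambda_ring lamR" and "lambda_ring lamS"
  shows "bij_betw (tau m lamR) seqs seqs
    \<and> (\<forall>a b. tau m lamR (W_add m a b) = B_add (tau m lamR a) (tau m lamR b))
    \<and> (\<forall>a b. tau m lamR (W_mult m a b) = B_mult m lamR (tau m lamR a) (tau m lamR b))
    \<and> Phi m = phi m lamR \<circ> tau m lamR
    \<and> (\<forall>f. lambda_hom lamR lamS f \<longrightarrow> (\<forall>a. tau m lamS (f \<circ> a) = f \<circ> tau m lamR a))"
  by (intro conjI allI impI bij_betw_tau tau_W_add tau_W_mult Phi_eq_phi_tau tau_natural assms(1))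

end
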